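(* Let $Q$ be a positive definite quadratic form (PQF) in $n$ variables. Then $Q$ is inhomogeneous extreme if and only if $Q$ is inhomogeneous perfect and inhomogeneous eutactic.
   Context: A PQF in $n$ variables is a positive definite real symmetric $n\times n$ matrix $Q$, with $Q[x]=x^tQx$. The inhomogeneous minimum is $\mu(Q)=\max_{x\in\mathbb{R}^n}\min_{v\in\mathbb{Z}^n}Q[x-v]$, and the inhomogeneous Hermite invariant is $\gamma_i(Q)=\mu(Q)/(\det Q)^{1/n}$. $Q$ is called inhomogeneous extreme if it is a local maximum of $\gamma_i$ on the open cone of positive definite symmetric $n\times n$ matrices. For each $c\in\mathbb{R}^n$ attaining $\mu(Q)$ (i.e. $\min_{v\in\mathbb{Z}^n}Q[c-v]=\mu(Q)$) let $\mathrm{Min}_c Q=\{v\in\mathbb{Z}^n: Q[v-c]=\mu(Q)\}$. $Q$ is inhomogeneous perfect if for each such $c$ the linear span of the symmetric $(n+1)\times(n+1)$ matrices $\binom{1}{v}\binom{1}{v}^t$, $v\in\mathrm{Min}_cQ$, has dimension $\binom{n+2}{2}-1$. $Q$ is inhomogeneous eutactic if for each such $c$ there are positive reals $\alpha_v$ ($v\in\mathrm{Min}_cQ$) with $\begin{pmatrix}1 & c^t\\ c & cc^t+\frac{\mu(Q)}{n}Q^{-1}\end{pmatrix}=\sum_{v\in\mathrm{Min}_cQ}\alpha_v\binom{1}{v}\binom{1}{v}^t.$ *)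

theory Defs
  imports "HOL-Analysis.Analysis"
begin

definition qeval :: "real^'n^'n \<Rightarrow> real^'n \<Rightarrow> real" where
  "qeval Q x = x \<bullet> (Q *v x)"

definition pqf :: "real^'n^'n \<Rightarrow> bool" where
  "pqf Q \<longleftrightarrow> transpose Q = Q \<and> (\<forall>x. x \<noteq> 0 \<longrightarrow> qeval Q x > 0)"

definition int_lattice :: "(real^'n) set" where
  "int_lattice = {v. \<forall>i. v $ i \<in> \<int>}"

(* For positive definite Q the infimum below is attained, and so is the supremum in inhom_min
   (the function is continuous and periodic under translation by integer vectors). *)
definition lattice_min :: "real^'n^'n \<Rightarrow> real^'n \<Rightarrow> real" where
  "lattice_min Q x = (INF v\<in>int_lattice. qeval Q (x - v))"

definition inhom_min :: "real^'n^'n \<Rightarrow> real" where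
  "inhom_min Q = (SUP x. lattice_min Q x)"

definition inhom_hermite :: "real^'n^'n \<Rightarrow> real" where
  "inhom_hermite Q = inhom_min Q / root CARD('n) (det Q)"

definition inhom_extreme :: "real^'n^'n \<Rightarrow> bool" where
  "inhom_extreme Q \<longleftrightarrow>
     (\<exists>\<epsilon>>0. \<forall>Q'. pqf Q' \<and> dist Q' Q < \<epsilon> \<longrightarrow> inhom_hermite Q' \<le> inhom_hermite Q)"

definition deep_holes :: "real^'n^'n \<Rightarrow> (real^'n) set" where
  "deep_holes Q = {c. lattice_min Q c = inhom_min Q}"

definition Min_at :: "real^'n^'n \<Rightarrow> real^'n \<Rightarrow> (real^'n) set" where
  "Min_at Q c = {v \<in> int_lattice. qeval Q (v - c) = inhom_min Q}"

(* Matrices of size n + 1 are indexed by 'n option; None is the index of the extra first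
   row and column. *)
definition block_mat :: "real \<Rightarrow> real^'n \<Rightarrow> real^'n^'n \<Rightarrow> real^('n option)^('n option)" where
  "block_mat a b M = (\<chi> i j. case (i, j) of
       (None, None) \<Rightarrow> a
     | (None, Some l) \<Rightarrow> b $ l
     | (Some k, None) \<Rightarrow> b $ k
     | (Some k, Some l) \<Rightarrow> M $ k $ l)"

definition outer :: "real^'m \<Rightarrow> real^'m^'m" where
  "outer w = (\<chi> i j. w $ i * w $ j)"

definition homog :: "real^'n \<Rightarrow> real^('n option)" where
  "homog v = (\<chi> i. case i of None \<Rightarrow> 1 | Some k \<Rightarrow> v $ k)"

definition inhom_perfect :: "real^'n^'n \<Rightarrow> bool" where
  "inhom_perfect Q \<longleftrightarrow> (\<forall>c\<in>deep_holes Q.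
     dim (span ((\<lambda>v. outer (homog v)) ` Min_at Q c)) = ((CARD('n) + 2) choose 2) - 1)"

(* Min_at Q c is finite for positive definite Q, so the sum below is a genuine finite sum. *)
definition inhom_eutactic :: "real^'n^'n \<Rightarrow> bool" where
  "inhom_eutactic Q \<longleftrightarrow> (\<forall>c\<in>deep_holes Q. \<exists>\<alpha> :: real^'n \<Rightarrow> real.
     (\<forall>v\<in>Min_at Q c. \<alpha> v > 0) \<and>
     block_mat 1 c (outer c + (inhom_min Q / real CARD('n)) *\<^sub>R matrix_inv Q)
       = (\<Sum>v\<in>Min_at Q c. \<alpha> v *\<^sub>R outer (homog v)))"

end

theory Submission
  imports Defs
begin

text \<open>
  Let \<open>\<mu>\<close> be the inhomogeneous minimum of \<open>Q\<close>. Pair symmetric matrices of size \<open>n + 1\<close> by the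
  Euclidean inner product. The polynomial \<open>v \<mapsto> T[x - v] - m\<close> is represented by a matrix
  \<open>A(T, x, m)\<close>, in the sense that its value at \<open>v\<close> is the pairing with \<open>(1, v)(1, v)\<^sup>t\<close>, and its
  pairing with the left-hand side \<open>M\<close> of the eutaxy equation is
  \<open>T[x - c] + \<mu> s - m\<close> with \<open>s = tr (T Q\<^sup>-\<^sup>1) / n\<close>. By the arithmetic-geometric mean inequality
  \<open>s \<ge> (det T / det Q)\<^bsup>1/n\<^esup>\<close>, with equality only for multiples of \<open>Q\<close> and with a quadratic error
  near \<open>Q\<close>.

  If \<open>Q\<close> is extreme and \<open>B\<close> is nonnegative on the points of \<open>Min\<^sub>c Q\<close>, then \<open>A(Q, c, \<mu>) + t B\<close> has
  the form \<open>A(T, x, m)\<close> with \<open>m \<le> \<mu> (det T / det Q)\<^bsup>1/n\<^esup>\<close> for small \<open>t > 0\<close>; pairing with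
  \<open>M\<close> gives \<open>\<langle>B, M\<rangle> \<ge> 0\<close>, with equality only for multiples of \<open>A(Q, c, \<mu>)\<close>. Perfection is the
  case where \<open>B\<close> vanishes on \<open>Min\<^sub>c Q\<close>, and eutaxy follows by separating hyperplanes.

  Conversely, a sequence of better forms converging to \<open>Q\<close>, with points converging to some \<open>c\<close>,
  gives \<open>D = A(T, x, m) - s A(Q, c, \<mu>)\<close> that is positive on \<open>Min\<^sub>c Q\<close>. Perfection bounds
  \<open>\<langle>D, M\<rangle>\<close> below by a multiple of \<open>|D|\<close>, whereas it is at most of the order of \<open>|D|\<^sup>2\<close>.
\<close>

subsection \<open>Quadratic forms and the lattice minimum\<close>

lemma norm_matrix_vector_mult_le:
  fixes A :: "real^'n^'m"
  shows "norm (A *v x) \<le> norm A * norm x"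
proof -
  have "norm (A *v x) \<le> L2_set (\<lambda>i. norm (A $ i) * norm x) UNIV"
    unfolding norm_vec_def[of "A *v x"]
    by (intro L2_set_mono) (auto simp: matrix_vector_mul_component Cauchy_Schwarz_ineq2)
  also have "\<dots> = norm A * norm x"
    by (simp add: L2_set_left_distrib norm_vec_def[of A])
  finally show ?thesis .
qed

lemma symmetric_inner_matrix_vector:
  fixes S :: "real^'n^'n"
  assumes "transpose S = S"
  shows "(S *v x) \<bullet> y = x \<bullet> (S *v y)"
  by (metis assms dot_lmul_matrix transpose_matrix_vector)

lemma qeval_diff:
  fixes S :: "real^'n^'n"
  assumes "transpose S = S"
  shows "qeval S (x - y) = qeval S x - 2 * ((S *v x) \<bullet> y) + qeval S y"
  unfolding qeval_def
  using symmetric_inner_matrix_vector[OF assms, of x y] symmetric_inner_matrix_vector[OF assms, of y x]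
  by (simp add: matrix_vector_mult_diff_distrib inner_diff inner_commute)

lemma qeval_uminus [simp]: "qeval S (- x) = qeval S x"
  using matrix_vector_mult_scaleR[of S "-1" x] by (simp add: qeval_def)

lemma qeval_minus_commute: "qeval S (x - y) = qeval S (y - x)"
  using qeval_uminus[of S "x - y"] by simp

lemma qeval_scaleR: "qeval S (a *\<^sub>R x) = a\<^sup>2 * qeval S x"
  by (simp add: qeval_def matrix_vector_mult_scaleR power2_eq_square)

lemma qeval_zero [simp]: "qeval S 0 = 0"
  by (simp add: qeval_def)

lemma qeval_diff_matrix: "qeval (S - T) x = qeval S x - qeval T x"
  by (simp add: qeval_def matrix_vector_mult_diff_rdistrib inner_diff_right)

lemma qeval_scaleR_matrix: "qeval (a *\<^sub>R S) x = a * qeval S x"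
  by (simp add: qeval_def flip: scaleR_matrix_vector_assoc)

lemma abs_qeval_le: "\<bar>qeval S x\<bar> \<le> norm S * (norm x)\<^sup>2"
proof -
  have "\<bar>qeval S x\<bar> \<le> norm x * norm (S *v x)"
    unfolding qeval_def by (rule Cauchy_Schwarz_ineq2)
  also have "\<dots> \<le> norm x * (norm S * norm x)"
    by (intro mult_left_mono norm_matrix_vector_mult_le) auto
  finally show ?thesis by (simp add: power2_eq_square mult_ac)
qed

lemma tendsto_matrix_vector_mult [tendsto_intros]:
  fixes f :: "'a \<Rightarrow> real^'n^'m"
  assumes "(f \<longlongrightarrow> A) F" "(g \<longlongrightarrow> x) F"
  shows "((\<lambda>t. f t *v g t) \<longlongrightarrow> A *v x) F"
  unfolding matrix_vector_mult_def using assms by (auto intro!: tendsto_intros)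

lemma tendsto_qeval [tendsto_intros]:
  assumes "(f \<longlongrightarrow> S) F" "(g \<longlongrightarrow> x) F"
  shows "((\<lambda>t. qeval (f t) (g t)) \<longlongrightarrow> qeval S x) F"
  unfolding qeval_def using assms by (auto intro!: tendsto_intros)

lemma continuous_on_qeval [continuous_intros]:
  assumes "continuous_on S f" "continuous_on S g"
  shows "continuous_on S (\<lambda>t. qeval (f t) (g t))"
  using assms unfolding continuous_on_def by (auto intro!: tendsto_intros)

text \<open>A quantitative form of positive definiteness: for symmetric \<open>S\<close>,
  \<open>k\<close> is a lower bound for the least eigenvalue. The estimates near \<open>Q\<close>
  are expressed through it.\<close>

definition coercive :: "real \<Rightarrow> real^'n^'n \<Rightarrow> bool" where
  "coercive k S \<longleftrightarrow> 0 < k \<and> (\<forall>x. k * (norm x)\<^sup>2 \<le> qeval S x)"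

text \<open>The minimum over the compact unit sphere is positive, and homogeneity of degree two
  extends the bound to all vectors.\<close>

lemma pqf_coercive:
  fixes Q :: "real^'n^'n"
  assumes "pqf Q"
  obtains k where "coercive k Q"
proof -
  have ne: "sphere (0::real^'n) 1 \<noteq> {}" by simp
  have "continuous_on (sphere (0::real^'n) 1) (qeval Q)"
    by (intro continuous_intros)
  from continuous_attains_inf[OF compact_sphere ne this]
  obtain u :: "real^'n" where u: "norm u = 1" "\<And>x. norm x = 1 \<Longrightarrow> qeval Q u \<le> qeval Q x"
    by auto
  have "u \<noteq> 0" using u by auto
  then have pos: "qeval Q u > 0" using assms by (auto simp: pqf_def)
  have "qeval Q u * (norm x)\<^sup>2 \<le> qeval Q x" for x :: "real^'n"
  proof (cases "x = 0")
    case False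
    then have "qeval Q u \<le> qeval Q ((1 / norm x) *\<^sub>R x)" by (intro u) simp
    also have "\<dots> = qeval Q x / (norm x)\<^sup>2" by (simp add: qeval_scaleR power_divide)
    finally show ?thesis using False by (simp add: field_simps)
  qed auto
  with pos show ?thesis using that[of "qeval Q u"] by (auto simp: coercive_def)
qed

lemma coercive_imp_pqf: "coercive k S \<Longrightarrow> transpose S = S \<Longrightarrow> pqf S"
  unfolding coercive_def pqf_def
  by (metis mult_pos_pos order_less_le_trans zero_less_norm_iff zero_less_power)

lemma coercive_near:
  assumes "coercive k S" "dist T S \<le> k / 2"
  shows "coercive (k / 2) T"
proof -
  have "(k / 2) * (norm x)\<^sup>2 \<le> qeval T x" for x
  proof -
    have "\<bar>qeval (T - S) x\<bar> \<le> norm (T - S) * (norm x)\<^sup>2" by (rule abs_qeval_le)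
    also have "\<dots> \<le> (k / 2) * (norm x)\<^sup>2"
      using assms(2) by (intro mult_right_mono) (auto simp: dist_norm)
    finally have "\<bar>qeval T x - qeval S x\<bar> \<le> (k / 2) * (norm x)\<^sup>2"
      by (simp add: qeval_diff_matrix)
    moreover have "k * (norm x)\<^sup>2 \<le> qeval S x" using assms(1) by (simp add: coercive_def)
    moreover have "(k / 2) * (norm x)\<^sup>2 = k * (norm x)\<^sup>2 / 2" by simp
    ultimately show ?thesis by linarith
  qed
  then show ?thesis using assms by (auto simp: coercive_def)
qed

lemma coercive_norm_le:
  assumes "coercive k S"
  shows "k * norm x \<le> norm (S *v x)"
proof (cases "x = 0")
  case False
  have "k * (norm x)\<^sup>2 \<le> norm x * norm (S *v x)"
    using assms norm_cauchy_schwarz[of x "S *v x"] unfolding coercive_def qeval_def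
    by (meson order_trans)
  then show ?thesis using False by (simp add: power2_eq_square mult_ac)
qed auto

text \<open>Makes the form quadratically small in \<open>S *v x\<close>. It is applied to a
  difference \<open>x - c\<close> whose image under \<open>S\<close> can be read off the blocks of a
  small matrix.\<close>

lemma coercive_qeval_le:
  assumes "coercive k S"
  shows "qeval S x \<le> (norm (S *v x))\<^sup>2 / k"
proof -
  have k: "k > 0" using assms by (simp add: coercive_def)
  have "qeval S x \<le> norm x * norm (S *v x)"
    unfolding qeval_def by (rule norm_cauchy_schwarz)
  also have "\<dots> \<le> (norm (S *v x) / k) * norm (S *v x)"
    using coercive_norm_le[OF assms, of x] k by (intro mult_right_mono) (auto simp: field_simps)
  finally show ?thesis by (simp add: power2_eq_square)
qed

section \<open>Finiteness and translation properties of the integer lattice\<close>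

lemma finite_int_lattice_ball: "finite {v \<in> (int_lattice :: (real^'n) set). norm (v - a) \<le> R}"
proof -
  let ?B = "\<Union>i. {z \<in> \<int>. \<bar>z - a $ i\<bar> \<le> R}"
  have "finite {z \<in> \<int>. \<bar>z - b\<bar> \<le> R}" for b :: real
  proof -
    have "{z \<in> \<int>. \<bar>z - b\<bar> \<le> R} \<subseteq> real_of_int ` {\<lfloor>b - R\<rfloor>..\<lceil>b + R\<rceil>}"
    proof
      fix z assume z: "z \<in> {z \<in> \<int>. \<bar>z - b\<bar> \<le> R}"
      then obtain j where j: "z = real_of_int j" by (auto elim: Ints_cases)
      with z have "j \<in> {\<lfloor>b - R\<rfloor>..\<lceil>b + R\<rceil>}" by (auto simp: abs_le_iff) linarith+
      with j show "z \<in> real_of_int ` {\<lfloor>b - R\<rfloor>..\<lceil>b + R\<rceil>}" by blast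
    qed
    then show ?thesis by (rule finite_subset) auto
  qed
  then have "finite ?B" by auto
  then have "finite (PiE (UNIV :: 'n set) (\<lambda>_. ?B))" by (intro finite_PiE) auto
  moreover have "vec_nth ` {v \<in> int_lattice. norm (v - a) \<le> R} \<subseteq> PiE UNIV (\<lambda>_. ?B)"
  proof (intro image_subsetI PiE_I)
    fix v :: "real^'n" and i assume "v \<in> {v \<in> int_lattice. norm (v - a) \<le> R}"
    then show "v $ i \<in> ?B"
      using component_le_norm_cart[of "v - a" i] by (auto simp: int_lattice_def intro!: exI[of _ i])
  qed auto
  ultimately have "finite (vec_nth ` {v \<in> int_lattice. norm (v - a) \<le> R})"
    using finite_subset by blast
  then show ?thesis by (rule finite_imageD) (simp add: inj_on_def vec_nth_inject)
qed

lemma zero_in_int_lattice: "0 \<in> int_lattice"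
  by (simp add: int_lattice_def)

lemma add_in_int_lattice: "v \<in> int_lattice \<Longrightarrow> w \<in> int_lattice \<Longrightarrow> v + w \<in> int_lattice"
  by (simp add: int_lattice_def)

lemma int_lattice_floor:
  fixes x :: "real^'n"
  obtains v where "v \<in> int_lattice" "x - v \<in> cbox 0 (\<chi> i. 1)"
proof
  show "(\<chi> i. of_int \<lfloor>x $ i\<rfloor>) \<in> (int_lattice :: (real^'n) set)" by (simp add: int_lattice_def)
  show "x - (\<chi> i. of_int \<lfloor>x $ i\<rfloor>) \<in> cbox 0 (\<chi> i. 1)"
    by (auto simp: mem_box_cart) linarith
qed

lemma pqf_nonneg: "pqf Q \<Longrightarrow> 0 \<le> qeval Q x"
  by (cases "x = 0") (auto simp: pqf_def less_imp_le)

lemma lattice_min_le: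
  assumes "pqf Q" "v \<in> int_lattice"
  shows "lattice_min Q x \<le> qeval Q (x - v)"
  unfolding lattice_min_def
  by (rule cINF_lower) (use assms in \<open>auto intro!: bdd_belowI[of _ 0] pqf_nonneg\<close>)

lemma lattice_min_ge:
  assumes "\<And>v. v \<in> int_lattice \<Longrightarrow> m \<le> qeval Q (x - v)"
  shows "m \<le> lattice_min Q x"
  unfolding lattice_min_def
  by (rule cINF_greatest) (use assms zero_in_int_lattice in auto)

text \<open>The lattice absorbs the shift by \<open>w\<close>. This one inequality suffices for
  moving a point into the unit cube without lowering its lattice minimum.\<close>

lemma lattice_min_translate_le:
  assumes "pqf Q" "w \<in> int_lattice"
  shows "lattice_min Q x \<le> lattice_min Q (x - w)"
proof (rule lattice_min_ge)
  fix v :: "real^'a" assume "v \<in> int_lattice"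
  then show "lattice_min Q x \<le> qeval Q (x - w - v)"
    using lattice_min_le[OF assms(1), of "w + v" x] assms(2) by (simp add: add_in_int_lattice diff_diff_eq)
qed

text \<open>Needed for the supremum in \<open>inhom_min\<close> to be meaningful. Modulo the lattice
  every point lies in the compact unit cube, where \<open>qeval Q\<close> is bounded.\<close>

lemma bdd_above_lattice_min:
  fixes Q :: "real^'n^'n"
  assumes "pqf Q"
  shows "bdd_above (range (lattice_min Q))"
proof -
  have "compact (qeval Q ` cbox 0 (\<chi> i. 1))"
    by (intro compact_continuous_image continuous_intros) auto
  then have "bdd_above (qeval Q ` cbox 0 (\<chi> i. 1))"
    by (intro bounded_imp_bdd_above compact_imp_bounded)
  then obtain B where B: "\<And>y. y \<in> cbox 0 (\<chi> i. 1) \<Longrightarrow> qeval Q y \<le> B"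
    unfolding bdd_above_def by blast
  show ?thesis
  proof (rule bdd_aboveI2)
    fix x :: "real^'n"
    obtain v where "v \<in> int_lattice" "x - v \<in> cbox 0 (\<chi> i. 1)" by (rule int_lattice_floor)
    then show "lattice_min Q x \<le> B" using lattice_min_le[OF assms] B by (meson order_trans)
  qed
qed

lemma lattice_min_le_inhom_min: "pqf Q \<Longrightarrow> lattice_min Q x \<le> inhom_min Q"
  unfolding inhom_min_def by (rule cSUP_upper) (auto intro: bdd_above_lattice_min)

lemma less_inhom_minE:
  assumes "pqf Q" "y < inhom_min Q"
  obtains x where "y < lattice_min Q x"
  using assms less_cSUP_iff[OF _ bdd_above_lattice_min[OF assms(1)], of y] unfolding inhom_min_def by auto

text \<open>The centre of the unit cube differs from every lattice point by at least 1/2 in each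
  coordinate, so a single coordinate gives the bound \<open>k / 4\<close>.\<close>

lemma inhom_min_pos:
  fixes Q :: "real^'n^'n"
  assumes "pqf Q"
  shows "0 < inhom_min Q"
proof -
  obtain k where k: "coercive k Q" using pqf_coercive[OF assms] .
  let ?x = "(\<chi> i. 1/2) :: real^'n"
  have "k / 4 \<le> lattice_min Q ?x"
  proof (rule lattice_min_ge)
    fix v :: "real^'n" assume v: "v \<in> int_lattice"
    obtain i :: 'n where True by simp
    obtain j where j: "v $ i = real_of_int j" using v by (auto simp: int_lattice_def elim: Ints_cases)
    have "j \<le> 0 \<or> j \<ge> 1" by linarith
    then have "real_of_int j \<le> 0 \<or> real_of_int j \<ge> 1" by auto
    then have "1/2 \<le> \<bar>1/2 - real_of_int j\<bar>" by auto
    also have "\<dots> \<le> norm (?x - v)" using component_le_norm_cart[of "?x - v" i] j by simp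
    finally have "(1/2)\<^sup>2 \<le> (norm (?x - v))\<^sup>2" by (intro power_mono) auto
    then have "k * (1/4) \<le> k * (norm (?x - v))\<^sup>2"
      using k by (intro mult_left_mono) (auto simp: coercive_def power2_eq_square)
    also have "\<dots> \<le> qeval Q (?x - v)" using k unfolding coercive_def by blast
    finally show "k / 4 \<le> qeval Q (?x - v)" by simp
  qed
  then show ?thesis using lattice_min_le_inhom_min[OF assms, of ?x] k by (simp add: coercive_def)
qed

lemma finite_Min_at:
  assumes "pqf Q"
  shows "finite (Min_at Q c)"
proof -
  obtain k where k: "coercive k Q" using pqf_coercive[OF assms] .
  have "Min_at Q c \<subseteq> {v \<in> int_lattice. norm (v - c) \<le> sqrt (inhom_min Q / k)}"
  proof
    fix v assume v: "v \<in> Min_at Q c"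
    then have "k * (norm (v - c))\<^sup>2 \<le> inhom_min Q"
      using k by (simp add: Min_at_def coercive_def) metis
    then have "norm (v - c) \<le> sqrt (inhom_min Q / k)"
      using k by (intro real_le_rsqrt) (auto simp: field_simps coercive_def)
    then show "v \<in> {v \<in> int_lattice. norm (v - c) \<le> sqrt (inhom_min Q / k)}"
      using v by (auto simp: Min_at_def)
  qed
  then show ?thesis using finite_int_lattice_ball finite_subset by blast
qed

subsection \<open>Simultaneous diagonalization\<close>

text \<open>The first-order condition at the minimum \<open>t = 0\<close>, used in place of a
  Lagrange multiplier theorem.\<close>

lemma linear_coefficient_zero:
  fixes b c :: real
  assumes "\<And>t. 0 \<le> b * t + c * t\<^sup>2"
  shows "b = 0"
proof (rule ccontr)
  assume b: "b \<noteq> 0"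
  \<comment> \<open>\<open>c\<close> may be zero or negative. The majorant \<open>d\<close> is
    positive, and \<open>- b / (2 * d)\<close> minimises \<open>b * t + d * t^2\<close>.\<close>
  define d where "d = \<bar>c\<bar> + 1"
  have d: "d > 0" "c \<le> d" by (auto simp: d_def)
  have "0 \<le> b * (- b / (2 * d)) + c * (- b / (2 * d))\<^sup>2" by (rule assms)
  also have "\<dots> \<le> b * (- b / (2 * d)) + d * (- b / (2 * d))\<^sup>2"
    using d by (intro add_left_mono mult_right_mono) auto
  also have "\<dots> = - (b\<^sup>2 / (4 * d))"
    using d by (simp add: field_simps power2_eq_square)
  also have "\<dots> < 0" using b d by (simp add: zero_less_divide_iff)
  finally show False by simp
qed

text \<open>Induction on the index set: the next vector maximises \<open>T\<close> on the
  \<open>Q\<close>-unit sphere of the \<open>Q\<close>-orthogonal complement \<open>W\<close> of the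
  vectors already found.\<close>

lemma simultaneous_diagonalization_aux:
  fixes Q T :: "real^'n^'n" and I :: "'n set"
  assumes Q: "pqf Q" and T: "transpose T = T"
  shows "\<exists>p l. (\<forall>i\<in>I. \<forall>j\<in>I. p i \<bullet> (Q *v p j) = (if i = j then 1 else 0)) \<and>
    (\<forall>i\<in>I. T *v p i = l i *\<^sub>R (Q *v p i))"
  using finite[of I]
proof (induction I rule: finite_induct)
  case empty
  then show ?case by simp
next
  case (insert a I)
  then obtain p l where
    p: "\<And>i j. i \<in> I \<Longrightarrow> j \<in> I \<Longrightarrow> p i \<bullet> (Q *v p j) = (if i = j then 1 else 0)" and
    l: "\<And>i. i \<in> I \<Longrightarrow> T *v p i = l i *\<^sub>R (Q *v p i)"
    by blast
  have sQ: "transpose Q = Q" using Q by (simp add: pqf_def)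
  note symQ = symmetric_inner_matrix_vector[OF sQ] and symT = symmetric_inner_matrix_vector[OF T]
  define W where "W = {x. \<forall>i\<in>I. x \<bullet> (Q *v p i) = 0}"
  have W_scale: "t *\<^sub>R x \<in> W" if "x \<in> W" for t x using that by (auto simp: W_def)
  have W_add: "x + y \<in> W" if "x \<in> W" "y \<in> W" for x y
    using that by (auto simp: W_def inner_add_left)
  \<comment> \<open>Fewer than \<open>CARD('n)\<close> linear conditions define \<open>W\<close>, so
    it contains a nonzero vector.\<close>
  have "card I < CARD('n)"
    using insert.hyps by (metis UNIV_I card_seteq finite linorder_not_le top_greatest)
  then have "dim ((\<lambda>i. Q *v p i) ` I) < DIM(real^'n)"
    using dim_le_card[of "(\<lambda>i. Q *v p i) ` I" "(\<lambda>i. Q *v p i) ` I"] card_image_le[of I "\<lambda>i. Q *v p i"]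
    by (simp add: span_superset)
  then obtain w where w: "w \<noteq> 0" "w \<in> W"
    by (rule orthogonal_to_subspace_exists) (auto simp: W_def orthogonal_def span_base)
  define K where "K = W \<inter> {x. qeval Q x = 1}"
  have normalize: "(1 / sqrt (qeval Q x)) *\<^sub>R x \<in> K" if "x \<in> W" "x \<noteq> 0" for x
    using that Q by (auto simp: K_def W_scale qeval_scaleR power_divide pqf_def less_imp_le less_imp_neq[symmetric])
  have "W = (\<Inter>i\<in>I. {x. x \<bullet> (Q *v p i) = 0})" by (auto simp: W_def)
  then have "closed W"
    by (auto intro!: closed_INT closed_Collect_eq continuous_intros)
  moreover have "closed {x. qeval Q x = 1}" by (intro closed_Collect_eq continuous_intros)
  ultimately have "closed K" by (auto simp: K_def)
  moreover have "bounded K"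
  proof -
    obtain k where k: "coercive k Q" using pqf_coercive[OF Q] .
    have "norm x \<le> sqrt (1 / k)" if "x \<in> K" for x
    proof (rule real_le_rsqrt)
      have "k * (norm x)\<^sup>2 \<le> 1" using that k by (auto simp: K_def coercive_def) metis
      then show "(norm x)\<^sup>2 \<le> 1 / k" using k by (simp add: coercive_def field_simps)
    qed
    then show ?thesis by (rule boundedI)
  qed
  ultimately have "compact K" by (simp add: compact_eq_bounded_closed)
  moreover have "K \<noteq> {}" using normalize w by blast
  moreover have "continuous_on K (qeval T)" by (intro continuous_intros)
  ultimately obtain u where u: "u \<in> K" and max: "\<And>x. x \<in> K \<Longrightarrow> qeval T x \<le> qeval T u"
    using continuous_attains_sup by metis
  define m where "m = qeval T u"
  have uW: "u \<in> W" and u1: "qeval Q u = 1" using u by (auto simp: K_def)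
  have W_le: "0 \<le> m * qeval Q x - qeval T x" if "x \<in> W" for x
  proof (cases "x = 0")
    case False
    then have pos: "0 < qeval Q x" using Q by (simp add: pqf_def)
    have "qeval T ((1 / sqrt (qeval Q x)) *\<^sub>R x) \<le> m"
      unfolding m_def using max normalize[OF that False] by blast
    then show ?thesis using pos by (simp add: qeval_scaleR power_divide field_simps)
  qed simp
  \<comment> \<open>\<open>z\<close> is half the gradient at \<open>u\<close> of
    \<open>m * qeval Q x - qeval T x\<close>. It is orthogonal to \<open>W\<close> by the
    first-order condition and to each \<open>p i\<close> by the eigenvector equations; together
    these span the space, so \<open>z = 0\<close>.\<close>
  define z where "z = m *\<^sub>R (Q *v u) - T *v u"
  have zW: "z \<bullet> y = 0" if "y \<in> W" for y
  proof -
    have "0 \<le> (2 * (z \<bullet> y)) * t + (m * qeval Q y - qeval T y) * t\<^sup>2" for t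
    proof -
      have exp: "qeval S (u + t *\<^sub>R y) = qeval S u + 2 * ((S *v u) \<bullet> y) * t + qeval S y * t\<^sup>2"
        if "transpose S = S" for S
        using qeval_diff[OF that, of u "(- t) *\<^sub>R y"] by (simp add: qeval_scaleR)
      have "u + t *\<^sub>R y \<in> W" using that uW by (intro W_add W_scale)
      from W_le[OF this] show ?thesis
        unfolding exp[OF sQ] exp[OF T] u1 m_def[symmetric] z_def
        by (simp add: inner_diff_left algebra_simps)
    qed
    from linear_coefficient_zero[OF this] show ?thesis by simp
  qed
  have zp: "z \<bullet> p i = 0" if "i \<in> I" for i
    using uW l[OF that] that unfolding z_def W_def
    by (simp add: inner_diff_left symQ symT)
  have "z \<bullet> x = 0" for x
  proof -
    \<comment> \<open>Removing the \<open>Q\<close>-orthogonal projection onto the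
      \<open>p i\<close> leaves a vector of \<open>W\<close>.\<close>
    let ?y = "x - (\<Sum>i\<in>I. (x \<bullet> (Q *v p i)) *\<^sub>R p i)"
    have "?y \<in> W"
    proof -
      have "(\<Sum>k\<in>I. (x \<bullet> (Q *v p k)) * (p k \<bullet> (Q *v p i))) = x \<bullet> (Q *v p i)" if "i \<in> I" for i
      proof -
        have "(\<Sum>k\<in>I. (x \<bullet> (Q *v p k)) * (p k \<bullet> (Q *v p i)))
            = (\<Sum>k\<in>I. if k = i then x \<bullet> (Q *v p k) else 0)"
          using that by (intro sum.cong) (auto simp: p)
        then show ?thesis using that insert.hyps by simp
      qed
      then show ?thesis by (simp add: W_def inner_diff_left inner_sum_left)
    qed
    then have "z \<bullet> ?y = 0" by (rule zW)
    then show ?thesis using zp by (simp add: inner_diff_right inner_sum_right)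
  qed
  then have "z = 0" using inner_eq_zero_iff by blast
  then have Tu: "T *v u = m *\<^sub>R (Q *v u)" by (simp add: z_def)
  have uQp: "u \<bullet> (Q *v p i) = 0" "p i \<bullet> (Q *v u) = 0" if "i \<in> I" for i
    using uW that symQ[of "p i" u] by (auto simp: W_def inner_commute)
  show ?case
  proof (intro exI[of _ "p(a := u)"] exI[of _ "l(a := m)"] conjI ballI)
    fix i j assume "i \<in> insert a I" "j \<in> insert a I"
    then show "(p(a := u)) i \<bullet> (Q *v (p(a := u)) j) = (if i = j then 1 else 0)"
      using p uQp u1 insert.hyps by (auto simp: qeval_def)
  qed (use l Tu insert.hyps in auto)
qed

lemma transpose_mult_mult_component:
  fixes S P :: "real^'n^'n"
  shows "(transpose P ** S ** P) $ i $ j = column i P \<bullet> (S *v column j P)"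
proof -
  have "(transpose P ** S ** P) $ i $ j = (transpose P ** (S ** P)) $ i $ j"
    by (simp add: matrix_mul_assoc)
  also have "\<dots> = column i P \<bullet> column j (S ** P)"
    by (simp add: matrix_matrix_mult_def transpose_def column_def inner_vec_def)
  also have "column j (S ** P) = S *v column j P"
    by (simp add: matrix_matrix_mult_def matrix_vector_mult_def column_def)
  finally show ?thesis .
qed

lemma simultaneous_diagonalization:
  fixes Q T :: "real^'n^'n"
  assumes Q: "pqf Q" and T: "transpose T = T"
  obtains P :: "real^'n^'n" and l :: "'n \<Rightarrow> real"
  where "transpose P ** Q ** P = mat 1" "transpose P ** T ** P = (\<chi> i j. if i = j then l i else 0)"
proof -
  obtain p :: "'n \<Rightarrow> real^'n" and l where
    p: "\<And>i j. p i \<bullet> (Q *v p j) = (if i = j then 1 else 0)" and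
    l: "\<And>i. T *v p i = l i *\<^sub>R (Q *v p i)"
    using simultaneous_diagonalization_aux[OF assms, of UNIV]
    unfolding ball_UNIV by auto
  define P :: "real^'n^'n" where "P = (\<chi> i j. p j $ i)"
  have col: "column j P = p j" for j by (simp add: P_def column_def vec_eq_iff)
  show ?thesis
  proof
    show "transpose P ** Q ** P = mat 1"
      by (simp add: vec_eq_iff transpose_mult_mult_component col p mat_def)
    show "transpose P ** T ** P = (\<chi> i j. if i = j then l i else 0)"
      by (simp add: vec_eq_iff transpose_mult_mult_component col p l)
  qed
qed

section \<open>Determinant, inverse and eigenvalues relative to a positive definite form\<close>

lemma pqf_det_pos:
  assumes "pqf Q"
  shows "0 < det Q"
proof -
  have "transpose Q = Q" using assms by (simp add: pqf_def)
  from simultaneous_diagonalization[OF assms this]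
  obtain P :: "real^'a^'a" where "transpose P ** Q ** P = mat 1" by metis
  then have "det (transpose P ** Q ** P) = 1" by simp
  then have "det Q * (det P)\<^sup>2 = 1" by (simp add: det_mul power2_eq_square mult_ac)
  then show ?thesis 
    by (metis linorder_not_le mult_nonpos_nonneg zero_le_power2 zero_less_one)
qed

lemma pqf_matrix_inv:
  assumes "pqf Q"
  shows "Q ** matrix_inv Q = mat 1" "matrix_inv Q ** Q = mat 1"
proof -
  have "invertible Q" using pqf_det_pos[OF assms] invertible_det_nz by force
  then have "\<exists>A'. Q ** A' = mat 1 \<and> A' ** Q = mat 1" by (simp add: invertible_def)
  from someI_ex[OF this] show "Q ** matrix_inv Q = mat 1" "matrix_inv Q ** Q = mat 1"
    by (simp_all add: matrix_inv_def)
qed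

lemma matrix_inv_unique:
  fixes A B :: "real^'n^'n"
  assumes "A ** B = mat 1"
  shows "matrix_inv A = B"
proof -
  have BA: "B ** A = mat 1" using assms matrix_left_right_inverse by blast
  have "A ** matrix_inv A = mat 1 \<and> matrix_inv A ** A = mat 1"
    unfolding matrix_inv_def by (rule someI[of _ B]) (use assms BA in auto)
  then show ?thesis by (metis BA matrix_mul_assoc matrix_mul_lid matrix_mul_rid)
qed

lemma trace_mult_eq_inner:
  fixes A B :: "real^'n^'n"
  assumes "transpose A = A"
  shows "trace (A ** B) = A \<bullet> B"
proof -
  have "trace (A ** B) = trace (transpose A ** B)" by (simp add: assms)
  also have "\<dots> = (\<Sum>i\<in>UNIV. \<Sum>k\<in>UNIV. A $ k $ i * B $ k $ i)"
    by (simp add: trace_def matrix_matrix_mult_def transpose_def)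
  also have "\<dots> = A \<bullet> B" by (subst sum.swap) (simp add: inner_vec_def)
  finally show ?thesis .
qed

lemma transpose_matrix_inv:
  assumes "pqf Q"
  shows "transpose (matrix_inv Q) = matrix_inv Q"
proof -
  have "transpose (matrix_inv Q ** Q) = transpose (mat 1)" using pqf_matrix_inv(2)[OF assms] by simp
  then have "Q ** transpose (matrix_inv Q) = mat 1"
    using assms by (simp add: matrix_transpose_mul pqf_def transpose_mat)
  then show ?thesis using matrix_inv_unique by metis
qed

text \<open>The numbers \<open>l i\<close> are the eigenvalues of \<open>T\<close> relative to \<open>Q\<close>.\<close>

lemma relative_eigenvalues:
  fixes Q T :: "real^'n^'n"
  assumes Q: "pqf Q" and T: "transpose T = T"
  obtains p :: "'n \<Rightarrow> real^'n" and l :: "'n \<Rightarrow> real"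
  where "\<And>i. qeval Q (p i) = 1" "\<And>i. qeval T (p i) = l i"
    "det T = det Q * (\<Prod>i\<in>UNIV. l i)" "T \<bullet> matrix_inv Q = (\<Sum>i\<in>UNIV. l i)"
    "\<And>a. (\<And>i. l i = a) \<Longrightarrow> T = a *\<^sub>R Q"
proof -
  obtain P :: "real^'n^'n" and l where PQ: "transpose P ** Q ** P = mat 1"
    and PT: "transpose P ** T ** P = (\<chi> i j. if i = j then l i else 0)"
    using simultaneous_diagonalization[OF assms] .
  have dP: "det Q * (det P)\<^sup>2 = 1"
    using arg_cong[OF PQ, of det] by (simp add: det_mul power2_eq_square mult_ac)
  have "det T * (det P)\<^sup>2 = det (\<chi> i j. if i = j then l i else 0)"
    using arg_cong[OF PT, of det] by (simp add: det_mul power2_eq_square mult_ac)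
  also have "\<dots> = (\<Prod>i\<in>UNIV. l i)" by (subst det_diagonal) auto
  finally have dT: "det T * (det P)\<^sup>2 = (\<Prod>i\<in>UNIV. l i)" .
  have left: "(transpose P ** Q) ** P = mat 1" using PQ by simp
  then have right: "P ** (transpose P ** Q) = mat 1" using matrix_left_right_inverse by blast
  then have "transpose (P ** (transpose P ** Q)) = transpose (mat 1)" by simp
  then have QPP: "Q ** P ** transpose P = mat 1"
    using Q by (simp add: matrix_transpose_mul pqf_def transpose_mat matrix_mul_assoc)
  \<comment> \<open>This factorisation of the inverse turns \<open>T \<bullet> matrix_inv Q\<close>
    into the trace of the diagonal matrix \<open>transpose P ** T ** P\<close>.\<close>
  then have inv: "matrix_inv Q = P ** transpose P" by (intro matrix_inv_unique) (simp add: matrix_mul_assoc)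
  have "T \<bullet> matrix_inv Q = trace ((T ** P) ** transpose P)"
    by (simp add: trace_mult_eq_inner[OF T, symmetric] inv matrix_mul_assoc)
  also have "\<dots> = trace (transpose P ** (T ** P))" by (rule trace_mul_sym)
  also have "\<dots> = (\<Sum>i\<in>UNIV. l i)" using PT by (simp add: matrix_mul_assoc trace_def)
  finally have tr: "T \<bullet> matrix_inv Q = (\<Sum>i\<in>UNIV. l i)" .
  show ?thesis
  proof
    show "qeval Q (column i P) = 1" for i
      using transpose_mult_mult_component[of P Q i i] PQ by (simp add: qeval_def mat_def)
    show "qeval T (column i P) = l i" for i
      using transpose_mult_mult_component[of P T i i] PT by (simp add: qeval_def)
    show "det T = det Q * (\<Prod>i\<in>UNIV. l i)" using dP dT by (metis mult.assoc mult.commute mult.right_neutral)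
    show "T \<bullet> matrix_inv Q = (\<Sum>i\<in>UNIV. l i)" by (rule tr)
    fix a assume a: "\<And>i. l i = a"
    \<comment> \<open>\<open>T\<close> and \<open>a *\<^sub>R Q\<close> have the same transform
      under \<open>P\<close>; multiplying by \<open>Q ** P\<close> on the left and
      \<open>transpose P ** Q\<close> on the right undoes the transform.\<close>
    have "transpose P ** T ** P = a *\<^sub>R mat 1"
      unfolding PT by (simp add: a vec_eq_iff mat_def)
    also have "\<dots> = transpose P ** (a *\<^sub>R Q) ** P"
      using PQ by (metis matrix_scalar_ac scalar_matrix_assoc)
    finally have "(Q ** P) ** (transpose P ** T ** P) ** (transpose P ** Q) =
        (Q ** P) ** (transpose P ** (a *\<^sub>R Q) ** P) ** (transpose P ** Q)" by simp
    then have "(Q ** P ** transpose P) ** T ** (P ** (transpose P ** Q)) =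
        (Q ** P ** transpose P) ** (a *\<^sub>R Q) ** (P ** (transpose P ** Q))"
      by (simp add: matrix_mul_assoc)
    then show "T = a *\<^sub>R Q" unfolding QPP right by simp
  qed
qed

subsection \<open>The arithmetic-geometric mean inequality for determinants\<close>

lemma matrix_inv_inner_self:
  fixes Q :: "real^'n^'n"
  assumes "pqf Q"
  shows "Q \<bullet> matrix_inv Q = real CARD('n)"
  using assms pqf_matrix_inv(1)[OF assms] trace_mult_eq_inner[of Q "matrix_inv Q"]
  by (simp add: pqf_def trace_I)

text \<open>The arithmetic mean of the eigenvalues of \<open>T\<close> relative to \<open>Q\<close>;
  for positive definite forms \<open>rel_det\<close> is their geometric mean.\<close>

definition rel_trace :: "real^'n^'n \<Rightarrow> real^'n^'n \<Rightarrow> real" where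
  "rel_trace Q T = (T \<bullet> matrix_inv Q) / real CARD('n)"

definition rel_det :: "real^'n^'n \<Rightarrow> real^'n^'n \<Rightarrow> real" where
  "rel_det Q T = root CARD('n) (det T) / root CARD('n) (det Q)"

lemma rel_trace_self: "pqf Q \<Longrightarrow> rel_trace Q Q = 1"
  by (simp add: rel_trace_def matrix_inv_inner_self)

lemma rel_det_pos: "pqf Q \<Longrightarrow> pqf T \<Longrightarrow> 0 < rel_det Q T"
  by (simp add: rel_det_def pqf_det_pos)

text \<open>Dividing the eigenvalues by their arithmetic mean makes the deviations from 1 sum to
  zero. Both the mean inequality and its quadratic error then reduce to comparing
  \<open>ln (1 + y)\<close> with \<open>y\<close>.\<close>

lemma pqf_relative_eigenvalues:
  fixes Q T :: "real^'n^'n"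
  assumes Q: "pqf Q" and T: "pqf T"
  obtains p :: "'n \<Rightarrow> real^'n" and l :: "'n \<Rightarrow> real"
  where "\<And>i. qeval Q (p i) = 1" "\<And>i. qeval T (p i) = l i" "\<And>i. 0 < l i" "0 < rel_trace Q T"
    "ln (rel_det Q T) = ln (rel_trace Q T) + (\<Sum>i\<in>UNIV. ln (l i / rel_trace Q T)) / real CARD('n)"
    "(\<Sum>i\<in>UNIV. l i / rel_trace Q T - 1) = 0"
    "\<And>a. (\<And>i. l i = a) \<Longrightarrow> T = a *\<^sub>R Q"
proof -
  let ?n = "real CARD('n)"
  have "transpose T = T" using T by (simp add: pqf_def)
  from relative_eigenvalues[OF Q this] obtain p :: "'n \<Rightarrow> real^'n" and l
    where p: "\<And>i. qeval Q (p i) = 1" "\<And>i. qeval T (p i) = l i"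
    and d: "det T = det Q * (\<Prod>i\<in>UNIV. l i)" and t: "T \<bullet> matrix_inv Q = (\<Sum>i\<in>UNIV. l i)"
    and a: "\<And>a. (\<And>i. l i = a) \<Longrightarrow> T = a *\<^sub>R Q"
    by blast
  have "p i \<noteq> 0" for i using p(1)[of i] by auto
  then have l: "0 < l i" for i using T p(2)[of i] by (metis pqf_def)
  then have s: "0 < rel_trace Q T" by (simp add: rel_trace_def t sum_pos)
  have "rel_det Q T = root CARD('n) (\<Prod>i\<in>UNIV. l i)"
    using pqf_det_pos[OF Q] by (simp add: rel_det_def d real_root_mult)
  then have "ln (rel_det Q T) = (\<Sum>i\<in>UNIV. ln (l i)) / ?n"
    using l by (simp add: ln_root prod_pos) (intro ln_prod; simp add: less_imp_neq[symmetric])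
  also have "\<dots> = (\<Sum>i\<in>UNIV. ln (rel_trace Q T) + ln (l i / rel_trace Q T)) / ?n"
    using less_imp_neq[OF l, symmetric] s by (simp add: ln_div)
  also have "\<dots> = ln (rel_trace Q T) + (\<Sum>i\<in>UNIV. ln (l i / rel_trace Q T)) / ?n"
    by (simp add: sum.distrib add_divide_distrib)
  finally have "ln (rel_det Q T) = \<dots>" .
  moreover have "(\<Sum>i\<in>UNIV. l i / rel_trace Q T - 1) = 0"
  proof -
    have "(\<Sum>i\<in>UNIV. l i) = ?n * rel_trace Q T" by (simp add: rel_trace_def t)
    then show ?thesis using s by (simp add: sum_subtractf flip: sum_divide_distrib)
  qed
  ultimately show ?thesis using that p l s a by blast
qed

text \<open>Summing \<open>ln y \<le> y - 1\<close> over the normalised eigenvalues cancels the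
  linear terms. Equality makes every summand sharp, so all normalised eigenvalues are 1.\<close>

lemma rel_det_le_rel_trace:
  fixes Q T :: "real^'n^'n"
  assumes Q: "pqf Q" and T: "pqf T"
  shows "rel_det Q T \<le> rel_trace Q T"
    and "rel_det Q T = rel_trace Q T \<Longrightarrow> T = rel_trace Q T *\<^sub>R Q"
proof -
  obtain p l where l: "\<And>i::'n. 0 < l i" and s: "0 < rel_trace Q T"
    and e: "ln (rel_det Q T) = ln (rel_trace Q T) + (\<Sum>i\<in>UNIV. ln (l i / rel_trace Q T)) / real CARD('n)"
    and z: "(\<Sum>i\<in>UNIV. l i / rel_trace Q T - 1) = 0"
    and a: "\<And>a. (\<And>i. l i = a) \<Longrightarrow> T = a *\<^sub>R Q"
    using pqf_relative_eigenvalues[OF assms] by metis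
  have le: "ln (l i / rel_trace Q T) \<le> l i / rel_trace Q T - 1" for i
    using l s by (intro ln_le_minus_one) simp
  then have "(\<Sum>i\<in>UNIV. ln (l i / rel_trace Q T)) \<le> (\<Sum>i\<in>UNIV. l i / rel_trace Q T - 1)"
    by (intro sum_mono)
  then have "(\<Sum>i\<in>UNIV. ln (l i / rel_trace Q T)) / real CARD('n) \<le> 0"
    using z by (simp add: divide_le_0_iff)
  then have "ln (rel_det Q T) \<le> ln (rel_trace Q T)" using e by simp
  then show "rel_det Q T \<le> rel_trace Q T"
    using s rel_det_pos[OF assms] by simp
  assume "rel_det Q T = rel_trace Q T"
  then have "(\<Sum>i\<in>UNIV. ln (l i / rel_trace Q T)) = 0" using e by simp
  then have "(\<Sum>i\<in>UNIV. l i / rel_trace Q T - 1 - ln (l i / rel_trace Q T)) = 0"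
    using z by (simp add: sum_subtractf)
  then have "\<forall>i\<in>UNIV. l i / rel_trace Q T - 1 - ln (l i / rel_trace Q T) = 0"
    using le by (subst (asm) sum_nonneg_eq_0_iff) auto
  then have "l i / rel_trace Q T = 1" for i
    using l s by (intro ln_eq_minus_one) auto
  then have "l i = rel_trace Q T" for i using s by (simp add: field_simps)
  then show "T = rel_trace Q T *\<^sub>R Q" by (rule a)
qed

text \<open>Write \<open>h\<close> for the norm of \<open>T - rel_trace Q T *\<^sub>R Q\<close>. The
  deviations are at most \<open>2 * h / k\<close>, since the eigenvectors have squared norm at most
  \<open>1 / k\<close> and the mean is at least 1/2. Linear terms cancel and the logarithm has
  remainder at most \<open>2 * y^2\<close>, which yields the factor 8.\<close>

lemma rel_trace_minus_rel_det_le: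
  fixes Q T :: "real^'n^'n"
  assumes Q: "pqf Q" and T: "pqf T" and k: "coercive k Q"
    and half: "1 / 2 \<le> rel_trace Q T" and small: "norm (T - rel_trace Q T *\<^sub>R Q) \<le> k / 4"
  shows "rel_trace Q T - rel_det Q T \<le> 8 * rel_trace Q T * (norm (T - rel_trace Q T *\<^sub>R Q) / k)\<^sup>2"
proof -
  let ?s = "rel_trace Q T" and ?h = "norm (T - rel_trace Q T *\<^sub>R Q)" and ?n = "real CARD('n)"
  obtain p l where p: "\<And>i::'n. qeval Q (p i) = 1" "\<And>i. qeval T (p i) = l i"
    and l: "\<And>i. 0 < l i" and s: "0 < ?s"
    and e: "ln (rel_det Q T) = ln ?s + (\<Sum>i\<in>UNIV. ln (l i / ?s)) / ?n"
    and z: "(\<Sum>i\<in>UNIV. l i / ?s - 1) = 0"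
    using pqf_relative_eigenvalues[OF Q T] by metis
  have k0: "k > 0" using k by (simp add: coercive_def)
  define y where "y i = l i / ?s - 1" for i
  have y: "\<bar>y i\<bar> \<le> 2 * ?h / k" for i
  proof -
    have "k * (norm (p i))\<^sup>2 \<le> 1" using k p(1)[of i] unfolding coercive_def by metis
    then have pk: "(norm (p i))\<^sup>2 \<le> 1 / k" using k0 by (simp add: field_simps)
    have "l i - ?s = qeval (T - ?s *\<^sub>R Q) (p i)"
      by (simp add: qeval_diff_matrix qeval_scaleR_matrix p)
    then have "\<bar>l i - ?s\<bar> \<le> ?h * (norm (p i))\<^sup>2" by (simp add: abs_qeval_le)
    also have "\<dots> \<le> ?h * (1 / k)" using pk by (intro mult_left_mono) auto
    finally have 1: "\<bar>l i - ?s\<bar> \<le> ?h / k" by simp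
    have "\<bar>y i\<bar> = \<bar>l i - ?s\<bar> / ?s" using s by (simp add: y_def field_simps abs_div)
    also have "\<dots> \<le> (?h / k) / (1 / 2)" using 1 half s k0 by (intro frac_le) auto
    finally show ?thesis by (simp add: mult.commute)
  qed
  have "2 * ?h / k \<le> 1 / 2" using small k0 by (simp add: field_simps)
  then have y2: "\<bar>y i\<bar> \<le> 1 / 2" for i using y[of i] by linarith
  have "- (2 * (2 * ?h / k)\<^sup>2) \<le> ln (l i / ?s) - y i" for i
  proof -
    have "\<bar>ln (1 + y i) - y i\<bar> \<le> 2 * (y i)\<^sup>2" by (rule abs_ln_one_plus_x_minus_x_bound[OF y2])
    also have "\<dots> \<le> 2 * (2 * ?h / k)\<^sup>2"
      using power_mono[OF y[of i], of 2] by simp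
    finally show ?thesis by (simp add: y_def)
  qed
  then have "(\<Sum>i\<in>(UNIV::'n set). - (2 * (2 * ?h / k)\<^sup>2)) \<le> (\<Sum>i\<in>UNIV. ln (l i / ?s) - y i)"
    by (intro sum_mono)
  also have "\<dots> = (\<Sum>i\<in>UNIV. ln (l i / ?s))" using z by (simp add: sum_subtractf y_def)
  finally have "- (8 * (?h / k)\<^sup>2) \<le> (\<Sum>i\<in>UNIV. ln (l i / ?s)) / ?n"
    by (simp add: field_simps power2_eq_square)
  also have "\<dots> = ln (rel_det Q T / ?s)" using e s rel_det_pos[OF Q T] by (simp add: ln_div)
  \<comment> \<open>\<open>ln u \<le> u - 1\<close> leads back from logarithms to the difference
    itself.\<close>
  also have "\<dots> \<le> rel_det Q T / ?s - 1" using s rel_det_pos[OF Q T] by (intro ln_le_minus_one) simp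
  finally have "- (8 * (?h / k)\<^sup>2) * ?s \<le> (rel_det Q T / ?s - 1) * ?s"
    using s by (intro mult_right_mono) auto
  then show ?thesis using s by (simp add: algebra_simps)
qed

subsection \<open>Bordered matrices\<close>

lemma sum_UNIV_option: "(\<Sum>i\<in>UNIV. f i) = f None + (\<Sum>i\<in>UNIV. f (Some i))"
  for f :: "'n::finite option \<Rightarrow> 'b::comm_monoid_add"
  by (simp add: UNIV_option_conv sum.reindex)

lemma inner_block_mat:
  "block_mat a b M \<bullet> block_mat a' b' M' = a * a' + 2 * (b \<bullet> b') + M \<bullet> M'"
  by (simp add: inner_vec_def sum_UNIV_option block_mat_def sum.distrib)

lemma block_mat_eq_iff: "block_mat a b M = block_mat a' b' M' \<longleftrightarrow> a = a' \<and> b = b' \<and> M = M'"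
  by (auto simp: block_mat_def vec_eq_iff split: option.split)

lemma block_mat_add: "block_mat a b M + block_mat a' b' M' = block_mat (a + a') (b + b') (M + M')"
  by (auto simp: block_mat_def vec_eq_iff split: option.split)

lemma block_mat_diff: "block_mat a b M - block_mat a' b' M' = block_mat (a - a') (b - b') (M - M')"
  by (auto simp: block_mat_def vec_eq_iff split: option.split)

lemma block_mat_scaleR: "r *\<^sub>R block_mat a b M = block_mat (r * a) (r *\<^sub>R b) (r *\<^sub>R M)"
  by (auto simp: block_mat_def vec_eq_iff split: option.split)

lemma transpose_block_mat: "transpose (block_mat a b M) = block_mat a b (transpose M)"
  by (auto simp: block_mat_def transpose_def vec_eq_iff split: option.split)

lemma symmetric_block_matE:
  fixes B :: "real^('n::finite option)^('n option)"
  assumes "transpose B = B"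
  obtains a b M where "B = block_mat a b M" "transpose M = M"
proof -
  have sym: "B $ i $ j = B $ j $ i" for i j
    using arg_cong[OF assms, of "\<lambda>X. X $ j $ i"] by (simp add: transpose_def)
  have B: "B = block_mat (B $ None $ None) (\<chi> i. B $ None $ Some i) (\<chi> i j. B $ Some i $ Some j)"
    using sym by (auto simp: block_mat_def vec_eq_iff split: option.split)
  show ?thesis by (rule that[OF B]) (simp add: transpose_def vec_eq_iff sym)
qed

lemma norm_block_mat: "(norm (block_mat a b M))\<^sup>2 = a\<^sup>2 + 2 * (norm b)\<^sup>2 + (norm M)\<^sup>2"
  by (simp only: power2_norm_eq_inner inner_block_mat power2_eq_square[of a])

lemma norm_block_mat_ge: "norm b \<le> norm (block_mat a b M)" "norm M \<le> norm (block_mat a b M)"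
  by (rule power2_le_imp_le; simp add: norm_block_mat)+

lemma tendsto_block_mat [tendsto_intros]:
  assumes "(a \<longlongrightarrow> a0) F" "(b \<longlongrightarrow> b0) F" "(M \<longlongrightarrow> M0) F"
  shows "((\<lambda>t. block_mat (a t) (b t) (M t)) \<longlongrightarrow> block_mat a0 b0 M0) F"
proof (intro vec_tendstoI)
  fix i j
  show "((\<lambda>t. block_mat (a t) (b t) (M t) $ i $ j) \<longlongrightarrow> block_mat a0 b0 M0 $ i $ j) F"
    using assms by (cases i; cases j) (auto simp: block_mat_def intro!: tendsto_intros)
qed

section \<open>Matrices of inhomogeneous polynomials and the eutaxy matrix\<close>

lemma outer_homog: "outer (homog v) = block_mat 1 v (outer v)"
  by (auto simp: block_mat_def outer_def homog_def vec_eq_iff split: option.split)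

lemma transpose_outer: "transpose (outer v) = outer v"
  by (simp add: outer_def transpose_def vec_eq_iff mult.commute)

lemma inner_outer: "M \<bullet> outer v = qeval M v"
  by (simp add: qeval_def inner_vec_def outer_def matrix_vector_mult_def sum_distrib_left mult_ac)

text \<open>The symmetric matrix representing the inhomogeneous quadratic polynomial \<open>v \<mapsto> Q[x - v] - m\<close>.\<close>

definition shifted_form :: "real^'n^'n \<Rightarrow> real^'n \<Rightarrow> real \<Rightarrow> real^('n option)^('n option)" where
  "shifted_form Q x m = block_mat (qeval Q x - m) (- (Q *v x)) Q"

lemma transpose_shifted_form: "transpose Q = Q \<Longrightarrow> transpose (shifted_form Q x m) = shifted_form Q x m"
  by (simp add: shifted_form_def transpose_block_mat)

lemma inner_shifted_form_outer:
  "transpose Q = Q \<Longrightarrow> shifted_form Q x m \<bullet> outer (homog v) = qeval Q (x - v) - m"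
  by (simp add: shifted_form_def outer_homog inner_block_mat inner_outer qeval_diff)

definition eutaxy_mat :: "real^'n^'n \<Rightarrow> real^'n \<Rightarrow> real^('n option)^('n option)" where
  "eutaxy_mat Q c = block_mat 1 c (outer c + (inhom_min Q / real CARD('n)) *\<^sub>R matrix_inv Q)"

text \<open>The part built from \<open>c\<close> evaluates the polynomial at \<open>c\<close>; the
  inverse block adds the relative trace. For positive definite \<open>Q\<close>, the case
  \<open>T = Q\<close>, \<open>x = c\<close>, \<open>m = inhom_min Q\<close> gives zero.\<close>

lemma inner_shifted_form_eutaxy_mat:
  fixes T :: "real^'n^'n"
  assumes "transpose T = T"
  shows "shifted_form T x m \<bullet> eutaxy_mat Q c = qeval T (x - c) + inhom_min Q * rel_trace Q T - m"
  using qeval_diff[OF assms, of x c]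
  by (simp add: shifted_form_def eutaxy_mat_def inner_block_mat inner_add_right inner_outer rel_trace_def)

lemma transpose_eutaxy_mat: "pqf Q \<Longrightarrow> transpose (eutaxy_mat Q c) = eutaxy_mat Q c"
proof -
  assume "pqf Q"
  have add: "transpose (A + B) = transpose A + transpose B" for A B :: "real^'n^'n"
    by (simp add: transpose_def vec_eq_iff)
  show ?thesis
    by (simp add: eutaxy_mat_def transpose_block_mat add transpose_scalar transpose_outer
        transpose_matrix_inv[OF \<open>pqf Q\<close>])
qed

subsection \<open>Symmetric matrices and positive combinations\<close>

lemma subspace_symmetric_matrices: "subspace {B :: real^'m^'m. transpose B = B}"
  by (auto simp: subspace_def transpose_def vec_eq_iff)

text \<open>The one- and two-element index sets label 0/1 matrices with disjoint supports, which
  form an orthogonal basis.\<close>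

lemma dim_symmetric_matrices:
  "dim {B :: real^'m^'m. transpose B = B} = (CARD('m) + 1) choose 2"
proof -
  define P :: "'m set set" where "P = {s. card s = 1} \<union> {s. card s = 2}"
  define b :: "'m set \<Rightarrow> real^'m^'m" where "b s = (\<chi> i j. if {i, j} = s then 1 else 0)" for s
  have pair: "{i, j} \<in> P" for i j by (cases "i = j") (auto simp: P_def)
  have ex: "\<exists>i j. s = {i, j}" if "s \<in> P" for s
    using that by (auto simp: P_def card_1_singleton_iff card_2_iff)
  have nz: "b s \<noteq> 0" if "s \<in> P" for s
    using ex[OF that] by (auto simp: b_def vec_eq_iff)
  have orth: "b s \<bullet> b t = 0" if "s \<noteq> t" for s t
  proof -
    have "b s $ i $ j * b t $ i $ j = 0" for i j using that by (simp add: b_def)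
    then show ?thesis unfolding inner_vec_def inner_real_def by (intro sum.neutral ballI)
  qed
  have inj: "inj_on b P"
    using nz orth by (metis inj_onI inner_eq_zero_iff)
  have indep: "independent (b ` P)"
    using nz orth by (intro pairwise_orthogonal_independent) (auto simp: pairwise_def orthogonal_def, metis)
  have sub: "b ` P \<subseteq> {B. transpose B = B}"
    by (auto simp: b_def transpose_def vec_eq_iff insert_commute)
  have "{B :: real^'m^'m. transpose B = B} \<subseteq> span (b ` P)"
  proof
    fix B :: "real^'m^'m" assume "B \<in> {B. transpose B = B}"
    then have "transpose B = B" by simp
    from arg_cong[OF this, of "\<lambda>X. X $ j $ i" for i j]
    have sym: "B $ i $ j = B $ j $ i" for i j by (simp add: transpose_def)
    \<comment> \<open>The description is unique because symmetry makes an entry depend only on the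
      unordered pair of its indices.\<close>
    define a where "a s = (THE r. \<forall>i j. s = {i, j} \<longrightarrow> r = B $ i $ j)" for s
    have a: "a {i, j} = B $ i $ j" for i j
      unfolding a_def by (rule the_equality) (auto simp: doubleton_eq_iff sym)
    have "B = (\<Sum>s\<in>P. a s *\<^sub>R b s)"
    proof (simp only: vec_eq_iff, intro allI)
      fix i j
      have "(\<Sum>s\<in>P. a s *\<^sub>R b s) $ i $ j = (\<Sum>s\<in>P. if s = {i, j} then a s else 0)"
        unfolding sum_component b_def by (intro sum.cong) auto
      then show "B $ i $ j = (\<Sum>s\<in>P. a s *\<^sub>R b s) $ i $ j" using pair[of i j] by (simp add: a)
    qed
    then show "B \<in> span (b ` P)"
      by (rule ssubst) (intro span_sum span_scale span_base imageI)
  qed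
  then have "dim {B :: real^'m^'m. transpose B = B} = card (b ` P)"
    using basis_card_eq_dim[OF sub _ indep] by simp
  also have "\<dots> = card P" by (rule card_image[OF inj])
  also have "\<dots> = (CARD('m) choose 1) + (CARD('m) choose 2)"
    unfolding P_def using n_subsets[of "UNIV :: 'm set"] by (subst card_Un_disjoint) auto
  also have "\<dots> = (CARD('m) + 1) choose 2" by (simp add: numeral_2_eq_2)
  finally show ?thesis .
qed

text \<open>Duality inside the symmetric matrices: codimension one means that the orthogonal
  complement of \<open>G\<close> is a line, and \<open>A\<close> always lies in that
  complement.\<close>

lemma dim_span_eq_iff_orthogonal:
  fixes G :: "(real^'m^'m) set"
  assumes G: "G \<subseteq> {B. transpose B = B}"
    and A: "transpose A = A" "A \<noteq> 0" "\<And>x. x \<in> G \<Longrightarrow> A \<bullet> x = 0"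
  shows "dim (span G) = ((CARD('m) + 1) choose 2) - 1 \<longleftrightarrow>
    (\<forall>B. transpose B = B \<longrightarrow> (\<forall>x\<in>G. B \<bullet> x = 0) \<longrightarrow> (\<exists>r. B = r *\<^sub>R A))"
proof -
  let ?S = "{B :: real^'m^'m. transpose B = B}"
  let ?N = "{y \<in> ?S. \<forall>x \<in> span G. orthogonal x y}"
  have N: "?N = {B \<in> ?S. \<forall>x\<in>G. B \<bullet> x = 0}"
  proof -
    have "(\<forall>x\<in>span G. orthogonal x y) \<longleftrightarrow> (\<forall>x\<in>G. y \<bullet> x = 0)" for y
      using orthogonal_to_span[of _ G y]
      by (auto simp: orthogonal_commute orthogonal_def span_base inner_commute[of y])
    then show ?thesis by simp
  qed
  have "span G \<subseteq> ?S" using G subspace_symmetric_matrices span_minimal by blast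
  from dim_subspace_orthogonal_to_vectors[OF subspace_span subspace_symmetric_matrices this]
  have dim: "dim ?N + dim (span G) = (CARD('m) + 1) choose 2"
    by (simp add: dim_symmetric_matrices)
  have sub: "span {A} \<subseteq> ?N"
    unfolding N using A by (auto simp: span_singleton transpose_scalar)
  have dA: "dim (span {A}) = 1" using A(2) by simp
  have subN: "subspace ?N"
    unfolding N using subspace_symmetric_matrices by (auto simp: subspace_def inner_add_left)
  \<comment> \<open>This keeps the truncated subtraction of 1 exact.\<close>
  have "dim ?N \<ge> 1" using dim_subset[OF sub] dA by simp
  then have "dim (span G) = ((CARD('m) + 1) choose 2) - 1 \<longleftrightarrow> dim ?N = 1"
    using dim by linarith
  also have "\<dots> \<longleftrightarrow> ?N \<subseteq> span {A}"
  proof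
    assume "dim ?N = 1"
    then have "span {A} = ?N"
      using sub subN dA by (intro subspace_dim_equal) auto
    then show "?N \<subseteq> span {A}" by simp
  next
    assume "?N \<subseteq> span {A}"
    then have "?N = span {A}" using sub by blast
    then show "dim ?N = 1" using dA by simp
  qed
  also have "\<dots> \<longleftrightarrow> (\<forall>B. transpose B = B \<longrightarrow> (\<forall>x\<in>G. B \<bullet> x = 0) \<longrightarrow> (\<exists>r. B = r *\<^sub>R A))"
    unfolding N by (auto simp: span_singleton image_iff subset_iff)
  finally show ?thesis .
qed

section \<open>Cones and strictly positive combinations\<close>

lemma convex_cone_hull_insert_uminus_image:
  assumes V: "finite V" and x: "x \<in> convex_cone hull (insert (- M) (f ` V))"
  obtains \<beta> s where "\<And>v. v \<in> V \<Longrightarrow> 0 \<le> \<beta> v" "0 \<le> s" "x = (\<Sum>v\<in>V. \<beta> v *\<^sub>R f v) - s *\<^sub>R M"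
proof -
  \<comment> \<open>The explicit combinations form a convex cone containing all generators, so the
    hull lies in \<open>C\<close>.\<close>
  define C where "C = {x. \<exists>\<beta> s. (\<forall>v\<in>V. 0 \<le> \<beta> v) \<and> 0 \<le> s \<and> x = (\<Sum>v\<in>V. \<beta> v *\<^sub>R f v) - s *\<^sub>R M}"
  have C0: "0 \<in> C" unfolding C_def by (intro CollectI exI[of _ "\<lambda>_. 0"] exI[of _ 0]) auto
  have Cadd: "x + y \<in> C" if "x \<in> C" "y \<in> C" for x y
  proof -
    obtain \<beta> s \<beta>' s' where "\<forall>v\<in>V. 0 \<le> \<beta> v" "0 \<le> s" "x = (\<Sum>v\<in>V. \<beta> v *\<^sub>R f v) - s *\<^sub>R M"
      "\<forall>v\<in>V. 0 \<le> \<beta>' v" "0 \<le> s'" "y = (\<Sum>v\<in>V. \<beta>' v *\<^sub>R f v) - s' *\<^sub>R M"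
      using \<open>x \<in> C\<close> \<open>y \<in> C\<close> unfolding C_def by blast
    then show ?thesis unfolding C_def
      by (intro CollectI exI[of _ "\<lambda>v. \<beta> v + \<beta>' v"] exI[of _ "s + s'"])
        (auto simp: scaleR_add_left sum.distrib)
  qed
  have Cscale: "r *\<^sub>R x \<in> C" if "x \<in> C" "0 \<le> r" for x r
  proof -
    obtain \<beta> s where "\<forall>v\<in>V. 0 \<le> \<beta> v" "0 \<le> s" "x = (\<Sum>v\<in>V. \<beta> v *\<^sub>R f v) - s *\<^sub>R M"
      using \<open>x \<in> C\<close> unfolding C_def by blast
    then show ?thesis using \<open>0 \<le> r\<close> unfolding C_def
      by (intro CollectI exI[of _ "\<lambda>v. r * \<beta> v"] exI[of _ "r * s"])
        (auto simp: scaleR_diff_right scaleR_sum_right)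
  qed
  have CM: "- M \<in> C" unfolding C_def by (intro CollectI exI[of _ "\<lambda>_. 0"] exI[of _ 1]) auto
  have Cf: "f w \<in> C" if "w \<in> V" for w
    unfolding C_def using that V
    by (intro CollectI exI[of _ "\<lambda>v. if v = w then 1 else 0"] exI[of _ 0])
      (auto simp: if_distrib[of "\<lambda>r. r *\<^sub>R _"] cong: if_cong)
  have "convex_cone C"
    unfolding convex_cone_iff using C0 Cadd Cscale by blast
  then have "convex_cone hull (insert (- M) (f ` V)) \<subseteq> C"
    using CM Cf by (intro hull_minimal) auto
  then show ?thesis using x that unfolding C_def by blast
qed

text \<open>A Farkas lemma with strict coefficients. Membership of \<open>- f w\<close> in the cone
  generated by \<open>- M\<close> and the \<open>f v\<close> writes a multiple of \<open>M\<close>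
  with positive weight on \<open>f w\<close>; averaging over \<open>w\<close> makes all weights
  positive.\<close>

lemma positive_combination_exists:
  fixes f :: "'b \<Rightarrow> 'a::euclidean_space"
  assumes V: "finite V" and z: "\<And>v. v \<in> V \<Longrightarrow> 0 < z \<bullet> f v"
    and nonneg: "\<And>B. (\<And>v. v \<in> V \<Longrightarrow> 0 \<le> B \<bullet> f v) \<Longrightarrow> 0 \<le> B \<bullet> M"
    and zero: "\<And>B v. (\<And>v. v \<in> V \<Longrightarrow> 0 \<le> B \<bullet> f v) \<Longrightarrow> B \<bullet> M = 0 \<Longrightarrow> v \<in> V \<Longrightarrow> B \<bullet> f v = 0"
  shows "\<exists>\<alpha>. (\<forall>v\<in>V. 0 < \<alpha> v) \<and> M = (\<Sum>v\<in>V. \<alpha> v *\<^sub>R f v)"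
proof (cases "V = {}")
  case True
  \<comment> \<open>With no points the premise of \<open>nonneg\<close> is vacuous, so it applies to
    \<open>- M\<close>.\<close>
  then have "0 \<le> (- M) \<bullet> M" by (intro nonneg) auto
  then have "M = 0" by (metis inner_eq_zero_iff inner_ge_zero inner_minus_left neg_0_le_iff_le order_antisym)
  then show ?thesis using True by simp
next
  case False
  have "\<exists>\<alpha>. (\<forall>v\<in>V. 0 \<le> \<alpha> v) \<and> 0 < \<alpha> w \<and> M = (\<Sum>v\<in>V. \<alpha> v *\<^sub>R f v)" if w: "w \<in> V" for w
  proof -
    let ?C = "convex_cone hull (insert (- M) (f ` V))"
    have C: "convex ?C" "closed ?C"
      using V by (auto simp: convex_convex_cone_hull closed_convex_cone_hull)
    \<comment> \<open>A separating functional would be nonnegative on all generators, hence zero on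
      \<open>M\<close> by \<open>nonneg\<close>, hence zero on \<open>f w\<close> by
      \<open>zero\<close>, against strict separation.\<close>
    have "- f w \<in> ?C"
    proof (rule ccontr)
      assume "- f w \<notin> ?C"
      then obtain a b where a: "a \<bullet> (- f w) < b" and b: "\<And>x. x \<in> ?C \<Longrightarrow> b < a \<bullet> x"
        using separating_hyperplane_closed_point[OF C] by blast
      have b0: "b < 0" using b[OF convex_cone_hull_contains_0] by simp
      have ge: "0 \<le> a \<bullet> x" if "x \<in> ?C" for x
      proof (rule ccontr)
        assume neg: "\<not> 0 \<le> a \<bullet> x"
        have "(b / (a \<bullet> x)) *\<^sub>R x \<in> ?C"
          using neg b0 that by (intro convex_cone_hull_mul) (auto simp: zero_le_divide_iff)
        from b[OF this] show False using neg by simp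
      qed
      have fC: "f v \<in> ?C" if "v \<in> V" for v using that by (intro hull_inc) auto
      have MC: "- M \<in> ?C" by (intro hull_inc) auto
      have "a \<bullet> M = 0" using ge[OF MC] nonneg[of a] ge[OF fC] by simp
      then have "a \<bullet> f w = 0" using zero[of a w] ge[OF fC] w by blast
      then show False using a b0 by simp
    qed
    then obtain \<beta> s where \<beta>: "\<And>v. v \<in> V \<Longrightarrow> 0 \<le> \<beta> v" and s: "0 \<le> s"
      and eq: "- f w = (\<Sum>v\<in>V. \<beta> v *\<^sub>R f v) - s *\<^sub>R M"
      by (rule convex_cone_hull_insert_uminus_image[OF V]) blast
    define \<alpha> where "\<alpha> v = \<beta> v + (if v = w then 1 else 0)" for v
    have sM: "s *\<^sub>R M = (\<Sum>v\<in>V. \<alpha> v *\<^sub>R f v)"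
    proof -
      have "(\<Sum>v\<in>V. \<alpha> v *\<^sub>R f v) = (\<Sum>v\<in>V. \<beta> v *\<^sub>R f v + (if v = w then f v else 0))"
        by (intro sum.cong) (auto simp: \<alpha>_def scaleR_add_left)
      also have "\<dots> = (\<Sum>v\<in>V. \<beta> v *\<^sub>R f v) + f w" using V w by (simp add: sum.distrib)
      also have "\<dots> = s *\<^sub>R M" using eq by (simp add: algebra_simps)
      finally show ?thesis by simp
    qed
    \<comment> \<open>\<open>z\<close> rules out \<open>s = 0\<close>: the combination has
      coefficient at least 1 on \<open>f w\<close>.\<close>
    have "0 < z \<bullet> (s *\<^sub>R M)"
      unfolding sM inner_sum_right
      using V w z \<beta> by (intro sum_pos2[of _ w]) (auto simp: \<alpha>_def less_imp_le intro!: mult_pos_pos add_nonneg_pos)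
    then have "s \<noteq> 0" by auto
    with s have s: "0 < s" by simp
    have "M = (\<Sum>v\<in>V. (\<alpha> v / s) *\<^sub>R f v)"
      using arg_cong[OF sM, of "\<lambda>x. (1 / s) *\<^sub>R x"] s by (simp add: scaleR_sum_right)
    moreover have "0 \<le> \<alpha> v" if "v \<in> V" for v using \<beta>[OF that] by (simp add: \<alpha>_def)
    moreover have "0 < \<alpha> w" using \<beta>[OF w] by (simp add: \<alpha>_def)
    ultimately show ?thesis using s by (intro exI[of _ "\<lambda>v. \<alpha> v / s"]) auto
  qed
  then obtain \<alpha> where \<alpha>: "\<And>w v. w \<in> V \<Longrightarrow> v \<in> V \<Longrightarrow> 0 \<le> \<alpha> w v" "\<And>w. w \<in> V \<Longrightarrow> 0 < \<alpha> w w"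
    "\<And>w. w \<in> V \<Longrightarrow> M = (\<Sum>v\<in>V. \<alpha> w v *\<^sub>R f v)"
    by metis
  let ?c = "real (card V)"
  have c: "0 < ?c" using V False by (simp add: card_gt_0_iff)
  have "?c *\<^sub>R M = (\<Sum>w\<in>V. \<Sum>v\<in>V. \<alpha> w v *\<^sub>R f v)"
    using sum.cong[OF refl \<alpha>(3), of V] by (simp add: scaleR_conv_of_real sum_constant_scaleR)
  also have "\<dots> = (\<Sum>v\<in>V. (\<Sum>w\<in>V. \<alpha> w v) *\<^sub>R f v)"
    by (subst sum.swap) (simp add: scaleR_sum_left)
  finally have "(1 / ?c) *\<^sub>R (?c *\<^sub>R M) = (1 / ?c) *\<^sub>R (\<Sum>v\<in>V. (\<Sum>w\<in>V. \<alpha> w v) *\<^sub>R f v)"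
    by simp
  then have "M = (\<Sum>v\<in>V. ((\<Sum>w\<in>V. \<alpha> w v) / ?c) *\<^sub>R f v)"
    using c unfolding scaleR_scaleR scaleR_sum_right by simp
  moreover have "0 < (\<Sum>w\<in>V. \<alpha> w v) / ?c" if v: "v \<in> V" for v
  proof -
    have "\<alpha> v v \<le> (\<Sum>w\<in>V. \<alpha> w v)" by (rule member_le_sum[OF v _ V]) (rule \<alpha>(1)[OF _ v], blast)
    with \<alpha>(2)[OF v] have "0 < (\<Sum>w\<in>V. \<alpha> w v)" by (rule less_le_trans)
    then show ?thesis using c by (rule divide_pos_pos)
  qed
  ultimately show ?thesis by (intro exI[of _ "\<lambda>v. (\<Sum>w\<in>V. \<alpha> w v) / ?c"] conjI ballI)
qed

subsection \<open>Necessity\<close>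

lemma inhom_min_le_qeval:
  assumes "pqf Q" "c \<in> deep_holes Q" "v \<in> int_lattice"
  shows "inhom_min Q \<le> qeval Q (c - v)"
  using lattice_min_le[OF assms(1,3), of c] assms(2) by (simp add: deep_holes_def)

lemma inner_shifted_form_Min_at:
  assumes "pqf Q" "v \<in> Min_at Q c"
  shows "shifted_form Q c (inhom_min Q) \<bullet> outer (homog v) = 0"
  using assms by (simp add: inner_shifted_form_outer pqf_def Min_at_def qeval_minus_commute[of Q c])

lemma shifted_form_nonzero: "pqf Q \<Longrightarrow> shifted_form Q x m \<noteq> 0"
proof
  assume Q: "pqf Q" and "shifted_form Q x m = 0"
  then have "shifted_form Q x m = block_mat 0 0 0"
    by (simp add: block_mat_def vec_eq_iff split: option.split)
  then have "Q = 0" by (simp add: shifted_form_def block_mat_eq_iff)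
  then show False using matrix_inv_inner_self[OF Q] by simp
qed

text \<open>Only the lattice points of \<open>Min_at Q c\<close> matter for the lattice minimum of nearby
  forms at nearby points: the finitely many other candidates in a ball have a gap to \<open>inhom_min Q\<close>,
  and the remaining points are too far away.\<close>

lemma eventually_lattice_min_ge:
  fixes Q :: "real^'n^'n" and T :: "'b \<Rightarrow> real^'n^'n"
  assumes Q: "pqf Q" and c: "c \<in> deep_holes Q"
    and T: "(T \<longlongrightarrow> Q) F" and x: "(x \<longlongrightarrow> c) F" and m: "(m \<longlongrightarrow> inhom_min Q) F"
  shows "\<forall>\<^sub>F t in F. (\<forall>v\<in>Min_at Q c. m t \<le> qeval (T t) (x t - v)) \<longrightarrow> m t \<le> lattice_min (T t) (x t)"
proof -
  let ?\<mu> = "inhom_min Q"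
  obtain k where k: "coercive k Q" using pqf_coercive[OF Q] .
  have k0: "0 < k" using k by (simp add: coercive_def)
  \<comment> \<open>Chosen so that \<open>(k / 2) * r^2 = ?\<mu> + 1\<close>, which exceeds
    \<open>m t\<close> eventually. The radius \<open>r + 1\<close> allows for \<open>x t\<close>
    being at distance up to 1 from \<open>c\<close>.\<close>
  define r where "r = sqrt (2 * (?\<mu> + 1) / k)"
  define S where "S = {v \<in> int_lattice. norm (v - c) \<le> r + 1} - Min_at Q c"
  have "finite S" unfolding S_def using finite_int_lattice_ball by blast
  moreover have "\<forall>\<^sub>F t in F. m t < qeval (T t) (x t - v)" if "v \<in> S" for v
  proof -
    have "?\<mu> \<noteq> qeval Q (c - v)"
      using that by (auto simp: S_def Min_at_def qeval_minus_commute[of Q c])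
    then have "0 < qeval Q (c - v) - ?\<mu>"
      using inhom_min_le_qeval[OF Q c, of v] that by (auto simp: S_def)
    moreover have "((\<lambda>t. qeval (T t) (x t - v) - m t) \<longlongrightarrow> qeval Q (c - v) - ?\<mu>) F"
      using T x m by (intro tendsto_intros)
    ultimately have "\<forall>\<^sub>F t in F. 0 < qeval (T t) (x t - v) - m t"
      by (rule order_tendstoD(1)[rotated])
    then show ?thesis by simp
  qed
  ultimately have near: "\<forall>\<^sub>F t in F. \<forall>v\<in>S. m t < qeval (T t) (x t - v)"
    by (simp add: eventually_ball_finite)
  have "\<forall>\<^sub>F t in F. dist (T t) Q < k / 2" using k0 by (intro tendstoD[OF T]) simp
  moreover have "\<forall>\<^sub>F t in F. dist (x t) c < 1" by (intro tendstoD[OF x]) simp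
  moreover have "\<forall>\<^sub>F t in F. m t < ?\<mu> + 1" by (rule order_tendstoD(2)[OF m]) simp
  ultimately show ?thesis using near
  proof eventually_elim
    case (elim t)
    show ?case
    proof (intro impI lattice_min_ge)
      fix v :: "real^'n"
      assume Min: "\<forall>v\<in>Min_at Q c. m t \<le> qeval (T t) (x t - v)" and v: "v \<in> int_lattice"
      consider "v \<in> Min_at Q c" | "v \<in> S" | "r + 1 < norm (v - c)"
        using v by (force simp: S_def)
      then show "m t \<le> qeval (T t) (x t - v)"
      proof cases
        case 3
        have "norm (v - c) \<le> norm (x t - v) + norm (x t - c)"
          using norm_triangle_ineq4[of "x t - c" "x t - v"] by (simp add: add.commute)
        then have "r < norm (x t - v)" using 3 elim by (simp add: dist_norm)
        moreover have "0 \<le> r" using inhom_min_pos[OF Q] k0 by (simp add: r_def)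
        ultimately have "r\<^sup>2 \<le> (norm (x t - v))\<^sup>2" by (intro power_mono) auto
        then have "(k / 2) * r\<^sup>2 \<le> (k / 2) * (norm (x t - v))\<^sup>2"
          using k0 by (intro mult_left_mono) auto
        moreover have "(k / 2) * r\<^sup>2 = ?\<mu> + 1"
          using inhom_min_pos[OF Q] k0 by (simp add: r_def)
        moreover have "(k / 2) * (norm (x t - v))\<^sup>2 \<le> qeval (T t) (x t - v)"
          using coercive_near[OF k, of "T t"] elim by (simp add: coercive_def)
        ultimately show ?thesis using elim by linarith
      qed (use Min elim in \<open>auto simp: less_imp_le\<close>)
    qed
  qed
qed

lemma inhom_hermite_le_iff:
  assumes "pqf Q" "pqf T"
  shows "inhom_hermite T \<le> inhom_hermite Q \<longleftrightarrow> inhom_min T \<le> inhom_min Q * rel_det Q T"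
  using pqf_det_pos[OF assms(1)] pqf_det_pos[OF assms(2)]
  by (simp add: inhom_hermite_def rel_det_def field_simps)

text \<open>For small \<open>t > 0\<close>, \<open>?A + t *\<^sub>R B\<close> is the shifted form of
  a nearby positive definite form, whose \<open>m\<close> is bounded by extremality. Pairing with
  the eutaxy matrix leaves a sum of nonnegative terms.\<close>

lemma inhom_extreme_supporting:
  fixes Q :: "real^'n^'n" and B :: "real^('n option)^('n option)"
  assumes Q: "pqf Q" and extreme: "inhom_extreme Q" and c: "c \<in> deep_holes Q"
    and B: "transpose B = B" and ge: "\<And>v. v \<in> Min_at Q c \<Longrightarrow> 0 \<le> B \<bullet> outer (homog v)"
  shows "0 \<le> B \<bullet> eutaxy_mat Q c"
    and "B \<bullet> eutaxy_mat Q c = 0 \<Longrightarrow> \<exists>r. B = r *\<^sub>R shifted_form Q c (inhom_min Q)"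
proof -
  let ?\<mu> = "inhom_min Q" and ?A = "shifted_form Q c (inhom_min Q)"
  have sQ: "transpose Q = Q" using Q by (simp add: pqf_def)
  obtain b0 b H where Bb: "B = block_mat b0 b H" and H: "transpose H = H"
    using symmetric_block_matE[OF B] .
  obtain k where k: "coercive k Q" using pqf_coercive[OF Q] .
  have k0: "0 < k" using k by (simp add: coercive_def)
  obtain \<epsilon> where \<epsilon>: "\<epsilon> > 0" and ext: "\<And>T. pqf T \<Longrightarrow> dist T Q < \<epsilon> \<Longrightarrow> inhom_hermite T \<le> inhom_hermite Q"
    using extreme unfolding inhom_extreme_def by blast
  define T where "T t = Q + t *\<^sub>R H" for t
  \<comment> \<open>Completing the square: the border of \<open>?A + t *\<^sub>R B\<close>
    prescribes \<open>T t *v x t\<close>, and its corner entry then determines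
    \<open>m t\<close>.\<close>
  define x where "x t = matrix_inv (T t) *v (Q *v c - t *\<^sub>R b)" for t
  define m where "m t = qeval (T t) (x t) - (qeval Q c - ?\<mu> + t * b0)" for t
  let ?F = "at_right (0::real)"
  have T_tendsto: "(T \<longlongrightarrow> Q) ?F"
    unfolding T_def by (auto intro!: tendsto_eq_intros)
  have sT: "transpose (T t) = T t" for t
    using sQ H by (simp add: T_def transpose_def vec_eq_iff)
  have ev_dist: "\<forall>\<^sub>F t in ?F. dist (T t) Q < min \<epsilon> (k / 2)"
    using \<epsilon> k0 by (intro tendstoD[OF T_tendsto]) simp
  have Tx: "T t *v x t = Q *v c - t *\<^sub>R b" if "pqf (T t)" for t
    using pqf_matrix_inv(1)[OF that] by (simp add: x_def matrix_vector_mul_assoc)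
  have coer: "coercive (k / 2) (T t)" if "dist (T t) Q < min \<epsilon> (k / 2)" for t
    using coercive_near[OF k, of "T t"] that by simp
  have pT: "pqf (T t)" if "dist (T t) Q < min \<epsilon> (k / 2)" for t
    using coercive_imp_pqf[OF coer[OF that] sT] .
  \<comment> \<open>The image of \<open>x t - c\<close> under \<open>T t\<close> is linear in
    \<open>t\<close>, and \<open>T t\<close> is coercive with the fixed constant
    \<open>k / 2\<close>.\<close>
  have x_bound: "norm (x t - c) \<le> \<bar>t\<bar> * (2 * norm (b + H *v c) / k)" if d: "dist (T t) Q < min \<epsilon> (k / 2)" for t
  proof -
    have "T t *v (x t - c) = - (t *\<^sub>R (b + H *v c))"
      by (simp add: matrix_vector_mult_diff_distrib Tx[OF pT[OF d]])
        (simp add: T_def matrix_vector_mult_add_rdistrib scaleR_add_right flip: scaleR_matrix_vector_assoc)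
    then have "(k / 2) * norm (x t - c) \<le> \<bar>t\<bar> * norm (b + H *v c)"
      using coercive_norm_le[OF coer[OF d], of "x t - c"] by simp
    then show ?thesis using k0 by (simp add: field_simps)
  qed
  have x_tendsto: "(x \<longlongrightarrow> c) ?F"
  proof (rule LIM_zero_cancel, rule Lim_null_comparison)
    show "\<forall>\<^sub>F t in ?F. norm (x t - c) \<le> \<bar>t\<bar> * (2 * norm (b + H *v c) / k)"
      using ev_dist by (rule eventually_mono) (rule x_bound)
    show "((\<lambda>t. \<bar>t\<bar> * (2 * norm (b + H *v c) / k)) \<longlongrightarrow> 0) ?F"
      using k0 by (auto intro!: tendsto_eq_intros)
  qed
  have m_tendsto: "(m \<longlongrightarrow> ?\<mu>) ?F"
  proof -
    have "(m \<longlongrightarrow> qeval Q c - (qeval Q c - ?\<mu> + 0 * b0)) ?F"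
      unfolding m_def using T_tendsto x_tendsto by (intro tendsto_intros)
    then show ?thesis by simp
  qed
  have "\<forall>\<^sub>F t in ?F. 0 < t" by (simp add: eventually_at_right_less)
  then have "\<forall>\<^sub>F t in ?F. 0 < t \<and> dist (T t) Q < min \<epsilon> (k / 2) \<and>
      ((\<forall>v\<in>Min_at Q c. m t \<le> qeval (T t) (x t - v)) \<longrightarrow> m t \<le> lattice_min (T t) (x t))"
    using ev_dist eventually_lattice_min_ge[OF Q c T_tendsto x_tendsto m_tendsto]
    by eventually_elim blast
  then obtain t where t: "0 < t" and d: "dist (T t) Q < min \<epsilon> (k / 2)"
    and lm: "(\<forall>v\<in>Min_at Q c. m t \<le> qeval (T t) (x t - v)) \<Longrightarrow> m t \<le> lattice_min (T t) (x t)"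
    using eventually_happens'[OF trivial_limit_at_right_real] by blast
  note pqfT = pT[OF d]
  have AB: "?A + t *\<^sub>R B = shifted_form (T t) (x t) (m t)"
    unfolding shifted_form_def Bb block_mat_scaleR block_mat_add block_mat_eq_iff
    by (simp add: m_def Tx[OF pqfT]) (simp add: T_def)
  have "m t \<le> qeval (T t) (x t - v)" if v: "v \<in> Min_at Q c" for v
  proof -
    have "0 \<le> (?A + t *\<^sub>R B) \<bullet> outer (homog v)"
      using ge[OF v] t inner_shifted_form_Min_at[OF Q v] by (simp add: inner_add_left)
    then show ?thesis unfolding AB inner_shifted_form_outer[OF sT] by simp
  qed
  then have "m t \<le> inhom_min (T t)"
    using lm lattice_min_le_inhom_min[OF pqfT, of "x t"] by force
  also have "\<dots> \<le> ?\<mu> * rel_det Q (T t)"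
    using ext[OF pqfT] d inhom_hermite_le_iff[OF Q pqfT] by simp
  finally have m_le: "m t \<le> ?\<mu> * rel_det Q (T t)" .
  have \<mu>: "0 < ?\<mu>" by (rule inhom_min_pos[OF Q])
  have "?A \<bullet> eutaxy_mat Q c = 0"
    by (simp add: inner_shifted_form_eutaxy_mat[OF sQ] rel_trace_self[OF Q])
  then have "t * (B \<bullet> eutaxy_mat Q c) = (?A + t *\<^sub>R B) \<bullet> eutaxy_mat Q c"
    by (simp add: inner_add_left)
  also have "\<dots> = qeval (T t) (x t - c) + ?\<mu> * rel_trace Q (T t) - m t"
    unfolding AB by (rule inner_shifted_form_eutaxy_mat[OF sT])
  finally have key: "t * (B \<bullet> eutaxy_mat Q c) = qeval (T t) (x t - c) + ?\<mu> * rel_trace Q (T t) - m t" .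
  have det_le: "?\<mu> * rel_det Q (T t) \<le> ?\<mu> * rel_trace Q (T t)"
    using \<mu> rel_det_le_rel_trace(1)[OF Q pqfT] by simp
  have nonneg: "0 \<le> qeval (T t) (x t - c)" by (rule pqf_nonneg[OF pqfT])
  have "0 \<le> t * (B \<bullet> eutaxy_mat Q c)" using key det_le nonneg m_le by linarith
  then show "0 \<le> B \<bullet> eutaxy_mat Q c" using t by (simp add: zero_le_mult_iff)
  assume "B \<bullet> eutaxy_mat Q c = 0"
  with key have zero: "qeval (T t) (x t - c) + ?\<mu> * rel_trace Q (T t) - m t = 0" by simp
  \<comment> \<open>\<open>qeval (T t) (x t - c)\<close> and the two gaps in \<open>m t \<le> ?\<mu>
    * rel_det Q (T t) \<le> ?\<mu> * rel_trace Q (T t)\<close> are nonnegative with sum zero, so all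
    three vanish.\<close>
  with det_le nonneg m_le have q0: "qeval (T t) (x t - c) = 0"
    and eq: "?\<mu> * rel_det Q (T t) = ?\<mu> * rel_trace Q (T t)" by linarith+
  let ?s = "rel_trace Q (T t)"
  have xc: "x t = c" using q0 pqfT unfolding pqf_def
    by (metis less_irrefl eq_iff_diff_eq_0)
  have TQ: "T t = ?s *\<^sub>R Q" using eq \<mu> rel_det_le_rel_trace(2)[OF Q pqfT] by simp
  have mt: "m t = ?s * ?\<mu>" using zero q0 by (simp add: mult.commute)
  have "?A + t *\<^sub>R B = ?s *\<^sub>R ?A"
    unfolding AB xc mt
    by (subst TQ) (simp add: shifted_form_def block_mat_scaleR block_mat_eq_iff qeval_scaleR_matrix
        right_diff_distrib flip: scaleR_matrix_vector_assoc)
  then have "t *\<^sub>R B = (?s - 1) *\<^sub>R ?A" by (simp add: algebra_simps)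
  then have "(1 / t) *\<^sub>R (t *\<^sub>R B) = (1 / t) *\<^sub>R ((?s - 1) *\<^sub>R ?A)" by simp
  then have "B = ((?s - 1) / t) *\<^sub>R ?A" using t by simp
  then show "\<exists>r. B = r *\<^sub>R ?A" ..
qed

text \<open>Separation takes place in the space of all matrices, while the perturbation argument
  needs a symmetric \<open>B\<close>; this bridges the two.\<close>

lemma inner_symmetrize:
  fixes B X :: "real^'m^'m"
  assumes "transpose X = X"
  shows "((1 / 2) *\<^sub>R (B + transpose B)) \<bullet> X = B \<bullet> X"
proof -
  have "transpose B \<bullet> X = B \<bullet> transpose X"
    unfolding inner_vec_def by (subst sum.swap) (simp add: transpose_def)
  then show ?thesis by (simp add: assms inner_add_left)
qed

text \<open>The two conclusions of \<open>inhom_extreme_supporting\<close> supply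
  \<open>nonneg\<close> and \<open>zero\<close> of the Farkas lemma, since multiples of the shifted
  form vanish on \<open>Min_at Q c\<close>.\<close>

lemma inhom_extreme_imp_eutactic:
  fixes Q :: "real^'n^'n"
  assumes Q: "pqf Q" and extreme: "inhom_extreme Q"
  shows "inhom_eutactic Q"
  unfolding inhom_eutactic_def eutaxy_mat_def[symmetric]
proof
  fix c assume c: "c \<in> deep_holes Q"
  let ?f = "\<lambda>v :: real^'n. outer (homog v)" and ?V = "Min_at Q c"
  have sym: "transpose ((1 / 2) *\<^sub>R (B + transpose B)) = (1 / 2) *\<^sub>R (B + transpose B)"
    for B :: "real^('n option)^('n option)"
    by (simp add: transpose_def vec_eq_iff add.commute)
  have fB: "((1 / 2) *\<^sub>R (B + transpose B)) \<bullet> ?f v = B \<bullet> ?f v"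
    and MB: "((1 / 2) *\<^sub>R (B + transpose B)) \<bullet> eutaxy_mat Q c = B \<bullet> eutaxy_mat Q c" for B v
    by (rule inner_symmetrize, simp add: transpose_outer transpose_eutaxy_mat[OF Q])+
  show "\<exists>\<alpha>. (\<forall>v\<in>?V. 0 < \<alpha> v) \<and> eutaxy_mat Q c = (\<Sum>v\<in>?V. \<alpha> v *\<^sub>R ?f v)"
  proof (rule positive_combination_exists)
    show "finite ?V" by (rule finite_Min_at[OF Q])
    \<comment> \<open>The corner matrix unit pairs to 1 with every point, so it serves as the
      strictly positive functional.\<close>
    show "0 < block_mat 1 0 0 \<bullet> ?f v" for v
      by (simp add: outer_homog inner_block_mat)
    fix B assume ge: "\<And>v. v \<in> ?V \<Longrightarrow> 0 \<le> B \<bullet> ?f v"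
    note K = inhom_extreme_supporting[OF Q extreme c sym[of B], unfolded fB MB, OF ge]
    show "0 \<le> B \<bullet> eutaxy_mat Q c" by (rule K(1))
    fix v assume "B \<bullet> eutaxy_mat Q c = 0" and v: "v \<in> ?V"
    then obtain r where "(1 / 2) *\<^sub>R (B + transpose B) = r *\<^sub>R shifted_form Q c (inhom_min Q)"
      using K(2) by blast
    then show "B \<bullet> ?f v = 0"
      using fB[of B v] inner_shifted_form_Min_at[OF Q v] by simp
  qed
qed

text \<open>Dual form of perfection: a polynomial of degree at most two vanishing on
  \<open>Min_at Q c\<close> is a multiple of \<open>qeval Q (c - v) - inhom_min Q\<close>.\<close>

lemma inhom_perfect_iff:
  fixes Q :: "real^'n^'n"
  assumes Q: "pqf Q"
  shows "inhom_perfect Q \<longleftrightarrow> (\<forall>c\<in>deep_holes Q. \<forall>B. transpose B = B \<longrightarrow>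
    (\<forall>v\<in>Min_at Q c. B \<bullet> outer (homog v) = 0) \<longrightarrow> (\<exists>r. B = r *\<^sub>R shifted_form Q c (inhom_min Q)))"
proof -
  have "dim (span ((\<lambda>v. outer (homog v)) ` Min_at Q c)) = ((CARD('n) + 2) choose 2) - 1 \<longleftrightarrow>
    (\<forall>B. transpose B = B \<longrightarrow> (\<forall>v\<in>Min_at Q c. B \<bullet> outer (homog v) = 0) \<longrightarrow>
      (\<exists>r. B = r *\<^sub>R shifted_form Q c (inhom_min Q)))" for c
  proof -
    have "CARD('n) + 2 = CARD('n option) + 1" by simp
    then show ?thesis
      using Q inner_shifted_form_Min_at[OF Q] shifted_form_nonzero[OF Q]
      by (simp only:, subst dim_span_eq_iff_orthogonal[where A = "shifted_form Q c (inhom_min Q)"])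
        (auto simp: transpose_outer transpose_shifted_form pqf_def)
  qed
  then show ?thesis by (simp add: inhom_perfect_def)
qed

text \<open>Both \<open>B\<close> and \<open>- B\<close> are nonnegative on
  \<open>Min_at Q c\<close>, so the pairing with the eutaxy matrix is zero and the equality case
  applies.\<close>

lemma inhom_extreme_imp_perfect:
  assumes Q: "pqf Q" and extreme: "inhom_extreme Q"
  shows "inhom_perfect Q"
  unfolding inhom_perfect_iff[OF Q]
proof (intro ballI allI impI)
  fix c B assume c: "c \<in> deep_holes Q" and B: "transpose B = B"
    and zero: "\<forall>v\<in>Min_at Q c. B \<bullet> outer (homog v) = 0"
  have "transpose (- B) = - B" using B by (simp add: transpose_def vec_eq_iff)
  then have "0 \<le> - B \<bullet> eutaxy_mat Q c"
    using zero by (intro inhom_extreme_supporting(1)[OF Q extreme c]) auto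
  moreover have "0 \<le> B \<bullet> eutaxy_mat Q c"
    using zero by (intro inhom_extreme_supporting(1)[OF Q extreme c B]) auto
  ultimately show "\<exists>r. B = r *\<^sub>R shifted_form Q c (inhom_min Q)"
    using zero by (intro inhom_extreme_supporting(2)[OF Q extreme c B]) auto
qed

subsection \<open>Sufficiency\<close>

lemma tendsto_det [tendsto_intros]:
  fixes T :: "'b \<Rightarrow> real^'n^'n"
  assumes "(T \<longlongrightarrow> Q) F"
  shows "((\<lambda>t. det (T t)) \<longlongrightarrow> det Q) F"
  unfolding det_def using assms by (auto intro!: tendsto_intros)

lemma tendsto_rel_det:
  assumes Q: "pqf Q" and T: "(T \<longlongrightarrow> Q) F"
  shows "((\<lambda>t. rel_det Q (T t)) \<longlongrightarrow> 1) F"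
proof -
  have "((\<lambda>t. rel_det Q (T t)) \<longlongrightarrow> rel_det Q Q) F"
    unfolding rel_det_def using T pqf_det_pos[OF Q] by (intro tendsto_intros) auto
  then show ?thesis using pqf_det_pos[OF Q] by (simp add: rel_det_def)
qed

lemma tendsto_rel_trace:
  assumes Q: "pqf Q" and T: "(T \<longlongrightarrow> Q) F"
  shows "((\<lambda>t. rel_trace Q (T t)) \<longlongrightarrow> 1) F"
proof -
  have "((\<lambda>t. rel_trace Q (T t)) \<longlongrightarrow> rel_trace Q Q) F"
    unfolding rel_trace_def using T by (intro tendsto_intros) auto
  then show ?thesis by (simp add: rel_trace_self[OF Q])
qed

text \<open>\<open>g\<close> attains a positive minimum on the unit sphere of \<open>S\<close>; the
  zero subspace has no unit vectors and is treated apart.\<close>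

lemma homogeneous_lower_bound:
  fixes g :: "'a::euclidean_space \<Rightarrow> real"
  assumes S: "subspace S" and g: "continuous_on UNIV g"
    and scale: "\<And>a x. g (a *\<^sub>R x) = \<bar>a\<bar> * g x" and pos: "\<And>x. x \<in> S \<Longrightarrow> x \<noteq> 0 \<Longrightarrow> 0 < g x"
  obtains \<delta> where "0 < \<delta>" "\<And>x. x \<in> S \<Longrightarrow> \<delta> * norm x \<le> g x"
proof (cases "S \<inter> sphere 0 1 = {}")
  case True
  have "x = 0" if "x \<in> S" for x
  proof (rule ccontr)
    assume "x \<noteq> 0"
    then have "(1 / norm x) *\<^sub>R x \<in> S \<inter> sphere 0 1" using that S by (auto simp: subspace_scale)
    then show False using True by blast
  qed
  then have "1 * norm x \<le> g x" if "x \<in> S" for x using that scale[of 0 0] by fastforce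
  then show ?thesis by (rule that[OF zero_less_one])
next
  case False
  have "compact (S \<inter> sphere 0 1)" using S by (simp add: closed_subspace closed_Int_compact)
  moreover have "continuous_on (S \<inter> sphere 0 1) g" using g continuous_on_subset by blast
  ultimately obtain u where u: "u \<in> S \<inter> sphere 0 1" "\<And>x. x \<in> S \<inter> sphere 0 1 \<Longrightarrow> g u \<le> g x"
    using continuous_attains_inf False by metis
  have "u \<noteq> 0" using u by auto
  then have "0 < g u" using pos u by simp
  moreover have "g u * norm x \<le> g x" if "x \<in> S" for x
  proof (cases "x = 0")
    case True
    then show ?thesis using scale[of 0 0] by simp
  next
    case False
    then have "(1 / norm x) *\<^sub>R x \<in> S \<inter> sphere 0 1" using that S by (auto simp: subspace_scale)
    from u(2)[OF this] show ?thesis using False by (simp add: scale field_simps)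
  qed
  ultimately show ?thesis using that by blast
qed

text \<open>If all points of \<open>Min_at Q c\<close> lay strictly beyond the bound,
  \<open>D\<close> would be positive on them. Perfection and eutaxy give
  \<open>\<delta> * norm D\<close> as a lower bound for its pairing with the eutaxy matrix, while
  the quadratic error gives \<open>C * norm D ^ 2\<close> as an upper bound; this fails for small
  nonzero \<open>D\<close>.\<close>

lemma perfect_eutactic_eventually:
  fixes Q :: "real^'n^'n" and T :: "'b \<Rightarrow> real^'n^'n"
  assumes Q: "pqf Q" and perfect: "inhom_perfect Q" and eutactic: "inhom_eutactic Q"
    and c: "c \<in> deep_holes Q" and T: "(T \<longlongrightarrow> Q) F" and x: "(x \<longlongrightarrow> c) F"
  shows "\<forall>\<^sub>F t in F. pqf (T t) \<longrightarrow>
    (\<exists>v\<in>Min_at Q c. qeval (T t) (x t - v) \<le> inhom_min Q * rel_det Q (T t))"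
proof -
  let ?\<mu> = "inhom_min Q" and ?V = "Min_at Q c" and ?f = "\<lambda>v :: real^'n. outer (homog v)"
  let ?A = "shifted_form Q c (inhom_min Q)" and ?E = "block_mat 0 0 (matrix_inv Q)"
  have sQ: "transpose Q = Q" using Q by (simp add: pqf_def)
  have \<mu>: "0 < ?\<mu>" by (rule inhom_min_pos[OF Q])
  obtain k where k: "coercive k Q" using pqf_coercive[OF Q] .
  have k0: "0 < k" using k by (simp add: coercive_def)
  obtain \<alpha> where \<alpha>: "\<And>v. v \<in> ?V \<Longrightarrow> 0 < \<alpha> v" and M: "eutaxy_mat Q c = (\<Sum>v\<in>?V. \<alpha> v *\<^sub>R ?f v)"
    using eutactic c unfolding inhom_eutactic_def eutaxy_mat_def[symmetric] by blast
  have V: "finite ?V" by (rule finite_Min_at[OF Q])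
  have V_ne: "?V \<noteq> {}"
  proof
    assume "?V = {}"
    then have "block_mat 1 0 0 \<bullet> eutaxy_mat Q c = 0" using M by simp
    then show False by (simp add: eutaxy_mat_def inner_block_mat)
  qed
  define g where "g D = (\<Sum>v\<in>?V. \<alpha> v * \<bar>D \<bullet> ?f v\<bar>)" for D
  \<comment> \<open>Perfection leaves only multiples of \<open>?A\<close> in the kernel of
    \<open>g\<close>, and \<open>?A \<bullet> ?E\<close> is the dimension, so \<open>S\<close>
    excludes the nonzero ones.\<close>
  define S where "S = {D. transpose D = D \<and> D \<bullet> ?E = 0}"
  obtain \<delta> where \<delta>: "0 < \<delta>" and g_ge: "\<And>D. D \<in> S \<Longrightarrow> \<delta> * norm D \<le> g D"
  proof (rule homogeneous_lower_bound[of S g])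
    show "subspace S"
      unfolding S_def using subspace_symmetric_matrices by (auto simp: subspace_def inner_add_left)
    show "continuous_on UNIV g" unfolding g_def by (intro continuous_intros)
    show "g (a *\<^sub>R D) = \<bar>a\<bar> * g D" for a D
      by (simp add: g_def abs_mult sum_distrib_left mult_ac)
    show "0 < g D" if D: "D \<in> S" "D \<noteq> 0" for D
    proof (rule ccontr)
      have nonneg: "\<And>v. v \<in> ?V \<Longrightarrow> 0 \<le> \<alpha> v * \<bar>D \<bullet> ?f v\<bar>" using \<alpha> by (simp add: less_imp_le)
      then have "0 \<le> g D" unfolding g_def by (rule sum_nonneg)
      moreover assume "\<not> 0 < g D"
      ultimately have "g D = 0" by simp
      then have "\<forall>v\<in>?V. \<alpha> v * \<bar>D \<bullet> ?f v\<bar> = 0"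
        unfolding g_def using V nonneg by (subst (asm) sum_nonneg_eq_0_iff) auto
      then have "\<forall>v\<in>?V. D \<bullet> ?f v = 0" using \<alpha> by fastforce
      then obtain r where r: "D = r *\<^sub>R ?A"
        using perfect c D unfolding inhom_perfect_iff[OF Q] S_def by blast
      have "?A \<bullet> ?E = real CARD('n)"
        by (simp add: shifted_form_def inner_block_mat matrix_inv_inner_self[OF Q])
      then have "r = 0" using D r by (simp add: S_def)
      then show False using D r by simp
    qed
    fix d :: real assume "0 < d" "\<And>D. D \<in> S \<Longrightarrow> d * norm D \<le> g D"
    then show thesis by (rule that)
  qed
  define s where "s t = rel_trace Q (T t)" for t
  define r where "r t = rel_det Q (T t)" for t
  have s: "(s \<longlongrightarrow> 1) F" unfolding s_def by (rule tendsto_rel_trace[OF Q T])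
  have r: "(r \<longlongrightarrow> 1) F" unfolding r_def by (rule tendsto_rel_det[OF Q T])
  text \<open>Subtracting \<open>s t *\<^sub>R ?A\<close> removes the scaling direction, along which no first-order
    estimate is available.\<close>
  define D where "D t = shifted_form (T t) (x t) (?\<mu> * r t) - s t *\<^sub>R ?A" for t
  have D_block: "D t = block_mat (qeval (T t) (x t) - ?\<mu> * r t - s t * (qeval Q c - ?\<mu>))
      (s t *\<^sub>R (Q *v c) - T t *v x t) (T t - s t *\<^sub>R Q)" for t
    by (simp add: D_def shifted_form_def block_mat_scaleR block_mat_diff)
  have D_tendsto: "(D \<longlongrightarrow> 0) F"
  proof -
    have "(D \<longlongrightarrow> block_mat (qeval Q c - ?\<mu> * 1 - 1 * (qeval Q c - ?\<mu>))
      (1 *\<^sub>R (Q *v c) - Q *v c) (Q - 1 *\<^sub>R Q)) F"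
      unfolding D_block using T x s r by (intro tendsto_intros)
    moreover have "block_mat 0 0 0 = (0 :: real^('n option)^('n option))"
      by (simp add: block_mat_def vec_eq_iff split: option.split)
    ultimately show ?thesis by simp
  qed
  \<comment> \<open>The first summand comes from \<open>qeval (T t) (x t - c)\<close>, the second
    from the gap between relative trace and relative determinant.\<close>
  define C where "C = (1 + norm c)\<^sup>2 * (2 / k) + ?\<mu> * (16 / k\<^sup>2)"
  have C0: "0 \<le> C" using k0 \<mu> by (simp add: C_def)
  \<comment> \<open>\<open>k / 4\<close> is the range of the mean-inequality estimate; the other
    bound gives the final contradiction.\<close>
  have "0 < min (k / 4) (\<delta> / (C + 1))" using k0 \<delta> C0 by simp
  from tendstoD[OF D_tendsto this]
  have "\<forall>\<^sub>F t in F. norm (D t) < min (k / 4) (\<delta> / (C + 1))" by simp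
  moreover have "\<forall>\<^sub>F t in F. dist (T t) Q < k / 2" using k0 by (intro tendstoD[OF T]) simp
  moreover have "\<forall>\<^sub>F t in F. 1 / 2 < s t" by (rule order_tendstoD(1)[OF s]) simp
  moreover have "\<forall>\<^sub>F t in F. s t < 2" by (rule order_tendstoD(2)[OF s]) simp
  ultimately show ?thesis
  proof eventually_elim
    case (elim t)
    show ?case
    proof (rule impI, rule ccontr)
      assume pT: "pqf (T t)"
      assume "\<not> (\<exists>v\<in>?V. qeval (T t) (x t - v) \<le> ?\<mu> * rel_det Q (T t))"
      then have gt: "\<And>v. v \<in> ?V \<Longrightarrow> ?\<mu> * r t < qeval (T t) (x t - v)" by (force simp: r_def)
      have sT: "transpose (T t) = T t" using pT by (simp add: pqf_def)
      have D_pos: "0 < D t \<bullet> ?f v" if v: "v \<in> ?V" for v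
        using gt[OF v] inner_shifted_form_Min_at[OF Q v]
        by (simp add: D_def inner_diff_left inner_shifted_form_outer[OF sT])
      obtain v where "v \<in> ?V" using V_ne by blast
      then have "D t \<noteq> 0" using D_pos by force
      then have D0: "0 < norm (D t)" by simp
      have "transpose (T t - s t *\<^sub>R Q) = T t - s t *\<^sub>R Q"
        using sT sQ by (simp add: transpose_def vec_eq_iff)
      moreover have "(T t - s t *\<^sub>R Q) \<bullet> matrix_inv Q = 0"
        by (simp add: inner_diff_left matrix_inv_inner_self[OF Q] s_def rel_trace_def)
      ultimately have "D t \<in> S"
        by (simp add: S_def D_block transpose_block_mat inner_block_mat)
      from g_ge[OF this] have "\<delta> * norm (D t) \<le> g (D t)" .
      \<comment> \<open>Positivity of \<open>D t\<close> on \<open>Min_at Q c\<close> removes the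
        absolute values, and the eutaxy equation sums up the terms.\<close>
      also have "g (D t) = D t \<bullet> eutaxy_mat Q c"
        unfolding g_def M inner_sum_right using D_pos by (intro sum.cong) (auto simp: less_imp_le)
      also have "\<dots> = qeval (T t) (x t - c) + ?\<mu> * (s t - r t)"
        by (simp add: D_def inner_diff_left inner_shifted_form_eutaxy_mat[OF sT]
            inner_shifted_form_eutaxy_mat[OF sQ] rel_trace_self[OF Q] s_def algebra_simps)
      also have "qeval (T t) (x t - c) \<le> (1 + norm c)\<^sup>2 * (2 / k) * (norm (D t))\<^sup>2"
      proof -
        have "coercive (k / 2) (T t)" using coercive_near[OF k] elim by simp
        then have "qeval (T t) (x t - c) \<le> (norm (T t *v (x t - c)))\<^sup>2 / (k / 2)"
          by (rule coercive_qeval_le)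
        also have "norm (T t *v (x t - c)) \<le> norm (D t) * (1 + norm c)"
        proof -
          \<comment> \<open>Both terms on the right come from blocks of \<open>D t\<close>.\<close>
          have "T t *v (x t - c) = - (s t *\<^sub>R (Q *v c) - T t *v x t) - (T t - s t *\<^sub>R Q) *v c"
            by (simp add: matrix_vector_mult_diff_distrib matrix_vector_mult_diff_rdistrib
                flip: scaleR_matrix_vector_assoc)
          then have "norm (T t *v (x t - c))
              \<le> norm (s t *\<^sub>R (Q *v c) - T t *v x t) + norm ((T t - s t *\<^sub>R Q) *v c)"
            by (metis norm_minus_cancel norm_triangle_ineq4)
          also have "norm (s t *\<^sub>R (Q *v c) - T t *v x t) \<le> norm (D t)"
            unfolding D_block by (rule norm_block_mat_ge)
          also have "norm ((T t - s t *\<^sub>R Q) *v c) \<le> norm (D t) * norm c"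
            by (rule order_trans[OF norm_matrix_vector_mult_le])
              (auto simp: D_block intro!: mult_right_mono norm_block_mat_ge)
          finally show ?thesis by (simp add: algebra_simps)
        qed
        then have "(norm (T t *v (x t - c)))\<^sup>2 / (k / 2) \<le> (norm (D t) * (1 + norm c))\<^sup>2 / (k / 2)"
          using k0 by (intro divide_right_mono power_mono) auto
        finally show ?thesis by (simp add: power_mult_distrib mult_ac)
      qed
      also have "?\<mu> * (s t - r t) \<le> ?\<mu> * (16 / k\<^sup>2) * (norm (D t))\<^sup>2"
      proof -
        have h: "norm (T t - s t *\<^sub>R Q) \<le> norm (D t)"
          unfolding D_block by (rule norm_block_mat_ge)
        have "s t - r t \<le> 8 * s t * (norm (T t - s t *\<^sub>R Q) / k)\<^sup>2"
          unfolding s_def r_def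
          by (rule rel_trace_minus_rel_det_le[OF Q pT k]) (use elim h in \<open>auto simp: s_def\<close>)
        also have "\<dots> \<le> 8 * 2 * (norm (D t) / k)\<^sup>2"
          using elim h k0 by (intro mult_mono power_mono divide_right_mono) auto
        finally have "?\<mu> * (s t - r t) \<le> ?\<mu> * (16 * (norm (D t) / k)\<^sup>2)"
          using \<mu> by (intro mult_left_mono) auto
        then show ?thesis by (simp add: power_divide)
      qed
      finally have "\<delta> * norm (D t) \<le> C * norm (D t) * norm (D t)"
        by (simp add: C_def power2_eq_square algebra_simps)
      then have "\<delta> \<le> C * norm (D t)" using D0 by simp
      also have "\<dots> \<le> (C + 1) * norm (D t)" using D0 by (intro mult_right_mono) auto
      also have "\<dots> < \<delta>" using elim C0 by (simp add: field_simps)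
      finally show False by simp
    qed
  qed
qed

text \<open>By compactness of the unit cube, a sequence of better forms tending to \<open>Q\<close>
  has points of large lattice minimum accumulating at a deep hole of \<open>Q\<close>, contradicting
  the local statement there.\<close>

lemma perfect_eutactic_imp_extreme:
  fixes Q :: "real^'n^'n"
  assumes Q: "pqf Q" and perfect: "inhom_perfect Q" and eutactic: "inhom_eutactic Q"
  shows "inhom_extreme Q"
proof (rule ccontr)
  let ?\<mu> = "inhom_min Q"
  assume not: "\<not> inhom_extreme Q"
  have "\<exists>T x. pqf T \<and> dist T Q < 1 / real (Suc j) \<and> x \<in> cbox 0 (\<chi> i. 1) \<and>
      ?\<mu> * rel_det Q T < lattice_min T x" for j
  proof -
    have "0 < 1 / real (Suc j)" by simp
    then obtain T where T: "pqf T" "dist T Q < 1 / real (Suc j)" "\<not> inhom_hermite T \<le> inhom_hermite Q"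
      using not unfolding inhom_extreme_def by blast
    then have "?\<mu> * rel_det Q T < inhom_min T" using inhom_hermite_le_iff[OF Q T(1)] by simp
    then obtain y where y: "?\<mu> * rel_det Q T < lattice_min T y" by (rule less_inhom_minE[OF T(1)])
    obtain v where v: "v \<in> int_lattice" "y - v \<in> cbox 0 (\<chi> i. 1)" by (rule int_lattice_floor)
    have "?\<mu> * rel_det Q T < lattice_min T (y - v)"
      using y lattice_min_translate_le[OF T(1) v(1), of y] by simp
    then show ?thesis using T v by blast
  qed
  then obtain T x where pT: "\<And>j. pqf (T j)" and dT: "\<And>j. dist (T j) Q < 1 / real (Suc j)"
    and x: "\<And>j. x j \<in> cbox 0 (\<chi> i. 1)" and less: "\<And>j. ?\<mu> * rel_det Q (T j) < lattice_min (T j) (x j)"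
    by metis
  have T_lim: "T \<longlonglongrightarrow> Q"
  proof (rule iffD2[OF tendsto_dist_iff], rule tendsto_sandwich[where f = "\<lambda>_. 0" and h = "\<lambda>j. 1 / real (Suc j)"])
    show "\<forall>\<^sub>F j in sequentially. dist (T j) Q \<le> 1 / real (Suc j)"
      by (intro always_eventually allI less_imp_le dT)
    show "(\<lambda>j. 1 / real (Suc j)) \<longlonglongrightarrow> 0"
      using LIMSEQ_inverse_real_of_nat by (simp only: inverse_eq_divide)
    show "(\<lambda>_. 0) \<longlonglongrightarrow> (0 :: real)" by (rule tendsto_const)
  qed simp
  have "compact (cbox 0 (\<chi> i. 1) :: (real^'n) set)" by simp
  then obtain c \<phi> where \<phi>: "strict_mono \<phi>" and x_lim: "(x \<circ> \<phi>) \<longlonglongrightarrow> c"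
    using x unfolding compact_def by blast
  have T_lim': "(T \<circ> \<phi>) \<longlonglongrightarrow> Q" by (rule LIMSEQ_subseq_LIMSEQ[OF T_lim \<phi>])
  \<comment> \<open>For each fixed lattice point the strict inequality passes to the limit in weak
    form, because the relative determinant tends to 1.\<close>
  have "?\<mu> \<le> lattice_min Q c"
  proof (rule lattice_min_ge)
    fix v :: "real^'n" assume v: "v \<in> int_lattice"
    have le: "?\<mu> * rel_det Q ((T \<circ> \<phi>) j) \<le> qeval ((T \<circ> \<phi>) j) ((x \<circ> \<phi>) j - v)" for j
      using less[of "\<phi> j"] lattice_min_le[OF pT v, of "\<phi> j" "x (\<phi> j)"] by simp
    have "(\<lambda>j. qeval ((T \<circ> \<phi>) j) ((x \<circ> \<phi>) j - v)) \<longlonglongrightarrow> qeval Q (c - v)"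
      using T_lim' x_lim by (intro tendsto_intros)
    moreover have "(\<lambda>j. ?\<mu> * rel_det Q ((T \<circ> \<phi>) j)) \<longlonglongrightarrow> ?\<mu> * 1"
      by (intro tendsto_intros tendsto_rel_det[OF Q T_lim'])
    ultimately have "?\<mu> * 1 \<le> qeval Q (c - v)"
      using le by (intro LIMSEQ_le) auto
    then show "?\<mu> \<le> qeval Q (c - v)" by simp
  qed
  then have c: "c \<in> deep_holes Q"
    using lattice_min_le_inhom_min[OF Q, of c] by (simp add: deep_holes_def)
  obtain j v where "v \<in> Min_at Q c"
    "qeval ((T \<circ> \<phi>) j) ((x \<circ> \<phi>) j - v) \<le> ?\<mu> * rel_det Q ((T \<circ> \<phi>) j)"
    using eventually_happens'[OF sequentially_bot perfect_eutactic_eventually[OF Q perfect eutactic c T_lim' x_lim]]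
      pT by auto
  then show False
    using less[of "\<phi> j"] lattice_min_le[OF pT, of v "\<phi> j" "x (\<phi> j)"] by (simp add: Min_at_def)
qed

theorem theorem2p4:
  fixes Q :: "real^'n^'n"
  assumes "pqf Q"
  shows "inhom_extreme Q \<longleftrightarrow> inhom_perfect Q \<and> inhom_eutactic Q"
  using assms inhom_extreme_imp_perfect inhom_extreme_imp_eutactic perfect_eutactic_imp_extreme
  by blast

end
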